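(* Let $T$ be a compact complex torus of complex dimension $n=\dim(T)\ge 2$. Then the following two conditions are equivalent: (i) For every connected complex Lie subgroup $H$ of $T$ (not necessarily closed), the closure $\overline{H}$ of $H$ in $T$ is a complex subtorus of $T$. (ii) There exists an elliptic curve $E$ with complex multiplication such that $T$ is isogenous to $E^n$.
   Context: A compact complex torus of dimension $n$ is a quotient $T=\mathbb{C}^n/\Gamma$, where $\Gamma$ is a lattice in $\mathbb{C}^n$ (a discrete subgroup of rank $2n$); let $\pi:\mathbb{C}^n\to T$ denote the projection. It is not assumed to be algebraic. A connected complex Lie subgroup $H$ of $T$ is an immersed subgroup that need not be closed, i.e. a subgroup of the form $H=\pi(V)$ for a complex vector subspace $V\subset\mathbb{C}^n$; equivalently $\pi^{-1}(H)=V+\Gamma$. Its closure $\overline{H}$ in $T$ is always a compact real subtorus of $T$, i.e. $\overline{H}=\pi(W)$ for a real vector subspace $W\subset\mathbb{C}^n$ with $\pi(W)$ closed. It is a complex subtorus if $W$ is a complex vector subspace of $\mathbb{C}^n$, i.e. if $\overline{H}$ is a closed connected complex Lie subgroup of $T$. Two compact complex tori of the same dimension are isogenous if there is a surjective holomorphic group homomorphism with finite kernel from one to the other. An elliptic curve is a compact complex torus $E$ of dimension one. $\operatorname{End}(E)$ denotes the ring of holomorphic Lie group homomorphisms from $E$ to itself, and $\operatorname{End}_{\mathbb{Q}}(E)=\operatorname{End}(E)\otimes_{\mathbb{Z}}\mathbb{Q}$. Lifting endomorphisms to the universal covering $(\mathbb{C},+)$ identifies $\operatorname{End}_{\mathbb{Q}}(E)$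 with a $\mathbb{Q}$-subalgebra of $\mathbb{C}$. The elliptic curve $E$ has complex multiplication if $\operatorname{End}_{\mathbb{Q}}(E)\neq\mathbb{Q}$. *)

theory Defs
  imports "HOL-Analysis.Analysis" "HOL-Algebra.Coset"
begin

text \<open>Vector spaces as \<open>\<int>\<close>-modules; in particular \<open>zmod.independent\<close> is linear independence
  over \<open>\<int>\<close> and \<open>zmod.span\<close> is the generated additive subgroup.\<close>

interpretation zmod: module "\<lambda>(k::int) (x::'a::real_vector). of_int k *\<^sub>R x"
  by unfold_locales (simp_all add: algebra_simps)

text \<open>A discrete additive subgroup of \<open>\<complex>\<^sup>n\<close> that is free abelian of rank \<open>2n\<close>
  (discrete subgroups of \<open>\<complex>\<^sup>n\<close> are free abelian, so the rank is the size of a \<open>\<int>\<close>-basis).\<close>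

definition complex_lattice :: "(complex^'n) set \<Rightarrow> bool" where
  "complex_lattice \<Gamma> \<longleftrightarrow>
     discrete \<Gamma> \<and> (\<exists>B. zmod.independent B \<and> zmod.span B = \<Gamma> \<and> card B = 2 * CARD('n))"

definition vector_group :: "'a::ab_group_add monoid" where
  "vector_group = \<lparr>carrier = UNIV, monoid.mult = (+), one = 0\<rparr>"

lemma comm_group_vector_group: "comm_group vector_group"
  by (rule comm_groupI) (auto simp: vector_group_def add.assoc add.commute intro: exI[of _ "- x" for x])

text \<open>The torus \<open>\<complex>\<^sup>n / \<Gamma>\<close>; its points are the cosets of \<open>\<Gamma>\<close>.\<close>

definition torus :: "(complex^'n) set \<Rightarrow> (complex^'n) set monoid" where
  "torus \<Gamma> = vector_group Mod \<Gamma>"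

definition torus_proj :: "(complex^'n) set \<Rightarrow> complex^'n \<Rightarrow> (complex^'n) set" where
  "torus_proj \<Gamma> x = \<Gamma> #>\<^bsub>vector_group\<^esub> x"

lemma torus_proj_eq: "torus_proj \<Gamma> x = (\<lambda>g. g + x) ` \<Gamma>"
  by (auto simp: torus_proj_def r_coset_def vector_group_def)

lemma carrier_torus: "carrier (torus \<Gamma>) = range (torus_proj \<Gamma>)"
  by (auto simp: torus_def FactGroup_def RCOSETS_def torus_proj_def vector_group_def)

text \<open>The quotient topology.\<close>

definition torus_topology :: "(complex^'n) set \<Rightarrow> (complex^'n) set topology" where
  "torus_topology \<Gamma> = topology (\<lambda>U. U \<subseteq> carrier (torus \<Gamma>) \<and> open (torus_proj \<Gamma> -` U))"

lemma openin_torus_topology: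
  "openin (torus_topology \<Gamma>) U \<longleftrightarrow> U \<subseteq> carrier (torus \<Gamma>) \<and> open (torus_proj \<Gamma> -` U)"
proof -
  have "istopology (\<lambda>U. U \<subseteq> carrier (torus \<Gamma>) \<and> open (torus_proj \<Gamma> -` U))"
    unfolding istopology_def by (auto simp: vimage_Union)
  then show ?thesis
    by (simp add: torus_topology_def)
qed

lemma topspace_torus_topology: "topspace (torus_topology \<Gamma>) = carrier (torus \<Gamma>)"
proof -
  have "torus_proj \<Gamma> -` carrier (torus \<Gamma>) = UNIV"
    by (auto simp: carrier_torus)
  then have "openin (torus_topology \<Gamma>) (carrier (torus \<Gamma>))"
    by (simp add: openin_torus_topology)
  then show ?thesis
    by (meson openin_subset openin_topspace openin_torus_topology subset_antisym)
qed

lemma quotient_map_torus_proj: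
  "quotient_map euclidean (torus_topology \<Gamma>) (torus_proj \<Gamma>)"
  by (auto simp: quotient_map_def topspace_torus_topology carrier_torus openin_torus_topology
        vimage_def)

text \<open>Note that \<open>vec.subspace\<close> is closed under complex scalars, whereas plain \<open>subspace\<close> would
  only mean a real subspace.\<close>

definition connected_complex_Lie_subgroup ::
    "(complex^'n) set \<Rightarrow> (complex^'n) set set \<Rightarrow> bool" where
  "connected_complex_Lie_subgroup \<Gamma> H \<longleftrightarrow> (\<exists>V. vec.subspace V \<and> H = torus_proj \<Gamma> ` V)"

definition complex_subtorus :: "(complex^'n) set \<Rightarrow> (complex^'n) set set \<Rightarrow> bool" where
  "complex_subtorus \<Gamma> K \<longleftrightarrow>
     connected_complex_Lie_subgroup \<Gamma> K \<and> closedin (torus_topology \<Gamma>) K"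

text \<open>Holomorphy in several variables: Frechet differentiable with \<open>\<complex>\<close>-linear derivative.\<close>

definition holomorphic_vec_on :: "(complex^'m \<Rightarrow> complex^'k) \<Rightarrow> (complex^'m) set \<Rightarrow> bool" where
  "holomorphic_vec_on F U \<longleftrightarrow>
     (\<forall>x\<in>U. \<exists>D. (F has_derivative D) (at x) \<and> Vector_Spaces.linear (*s) (*s) D)"

text \<open>The charts of a torus are the local inverses of its projection, so a map of tori is
  holomorphic iff it locally lifts to a holomorphic map of the universal coverings.\<close>

definition holomorphic_torus_map ::
    "(complex^'m) set \<Rightarrow> (complex^'k) set \<Rightarrow> ((complex^'m) set \<Rightarrow> (complex^'k) set) \<Rightarrow> bool" where
  "holomorphic_torus_map \<Gamma> \<Gamma>' \<phi> \<longleftrightarrow>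
     (\<forall>x. \<exists>U F. open U \<and> x \<in> U \<and> holomorphic_vec_on F U \<and>
              (\<forall>u\<in>U. \<phi> (torus_proj \<Gamma> u) = torus_proj \<Gamma>' (F u)))"

definition holomorphic_hom ::
    "(complex^'m) set \<Rightarrow> (complex^'k) set \<Rightarrow> ((complex^'m) set \<Rightarrow> (complex^'k) set) set" where
  "holomorphic_hom \<Gamma> \<Gamma>' = {\<phi> \<in> hom (torus \<Gamma>) (torus \<Gamma>'). holomorphic_torus_map \<Gamma> \<Gamma>' \<phi>}"

definition isogeny ::
    "(complex^'n) set \<Rightarrow> (complex^'n) set \<Rightarrow> ((complex^'n) set \<Rightarrow> (complex^'n) set) \<Rightarrow> bool" where
  "isogeny \<Gamma> \<Gamma>' \<phi> \<longleftrightarrow>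
     \<phi> \<in> holomorphic_hom \<Gamma> \<Gamma>' \<and>
     \<phi> ` carrier (torus \<Gamma>) = carrier (torus \<Gamma>') \<and>
     finite (kernel (torus \<Gamma>) (torus \<Gamma>') \<phi>)"

definition isogenous :: "(complex^'n) set \<Rightarrow> (complex^'n) set \<Rightarrow> bool" where
  "isogenous \<Gamma> \<Gamma>' \<longleftrightarrow> (\<exists>\<phi>. isogeny \<Gamma> \<Gamma>' \<phi>) \<or> (\<exists>\<phi>. isogeny \<Gamma>' \<Gamma> \<phi>)"

text \<open>An elliptic curve is \<open>torus \<Lambda>\<close> for a lattice \<open>\<Lambda>\<close> in \<open>complex^1\<close>.
  \<open>End_lifts \<Lambda>\<close> is the image of its endomorphism ring in \<open>\<complex>\<close> under lifting to the universal
  covering. Every element of \<open>End \<otimes> \<rat>\<close> is a pure tensor, so the image of \<open>End \<otimes> \<rat>\<close> in \<open>\<complex>\<close>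
  consists of the rational multiples of such lifts.\<close>

definition End_lifts :: "(complex^1) set \<Rightarrow> complex set" where
  "End_lifts \<Lambda> =
     {c. \<exists>\<phi> \<in> holomorphic_hom \<Lambda> \<Lambda>. \<forall>z. \<phi> (torus_proj \<Lambda> z) = torus_proj \<Lambda> (c *s z)}"

definition EndQ :: "(complex^1) set \<Rightarrow> complex set" where
  "EndQ \<Lambda> = {of_rat r * c |r c. c \<in> End_lifts \<Lambda>}"

definition complex_multiplication :: "(complex^1) set \<Rightarrow> bool" where
  "complex_multiplication \<Lambda> \<longleftrightarrow> EndQ \<Lambda> \<noteq> \<rat>"

text \<open>The lattice \<open>\<Lambda>\<^sup>n\<close> of the torus \<open>E\<^sup>n = (\<complex>/\<Lambda>)\<^sup>n = \<complex>\<^sup>n/\<Lambda>\<^sup>n\<close>. Here \<open>vec\<close> is the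
  identification of \<open>complex\<close> with \<open>complex^1\<close>.\<close>

definition lattice_power :: "(complex^1) set \<Rightarrow> (complex^'n) set" where
  "lattice_power \<Lambda> = {x. \<forall>i. vec (x $ i) \<in> \<Lambda>}"

end

theory Submission
  imports Defs
begin

text \<open>
  If a nonreal \<open>\<alpha>\<close> satisfies \<open>\<alpha> \<Gamma> \<subseteq> \<Gamma>\<close>, then for every complex subspace \<open>V\<close> the closed group
  \<open>C = closure (V + \<Gamma>)\<close> is \<open>\<alpha>\<close>-stable, hence so is its largest real subspace \<open>W\<close>, which is therefore
  complex; as \<open>C\<close> and \<open>W\<close> agree near \<open>0\<close>, \<open>C = W + \<Gamma>\<close>. Such an \<open>\<alpha>\<close> exists for \<open>\<Lambda>\<^sup>n\<close> with \<open>\<Lambda>\<close> CM, and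
  its existence is an isogeny invariant.

  Conversely, let \<open>f\<close> be a nonzero complex functional whose real part is integral on \<open>\<Gamma>\<close>, and
  \<open>V = ker f\<close>. The closure of \<open>V + \<Gamma>\<close> is \<open>W + \<Gamma>\<close> with \<open>Re f\<close> integral, hence zero, on \<open>W\<close>; if \<open>W\<close> is
  complex then \<open>f\<close> vanishes on \<open>W\<close>, so that \<open>f(\<Gamma>)\<close> is closed and countable, thus a lattice in \<open>\<complex>\<close>.
  Applied to \<open>f\<close>, \<open>g\<close> and \<open>f + g\<close> this shows that all lattices \<open>f(\<Gamma>)\<close> are commensurable, to \<open>\<Lambda>\<close> say.
  A basis of such functionals gives an isogeny to \<open>E\<^sup>n\<close>, where \<open>E = \<complex>/\<Lambda>\<close>, and comparing \<open>f\<close> with a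
  nonreal multiple \<open>c f\<close> of the same kind shows that \<open>E\<close> has complex multiplication.
\<close>

section \<open>Discrete and closed subgroups of Euclidean space\<close>

lemma uniform_discrete_subgroup:
  fixes D :: "'a::real_normed_vector set"
  assumes "discrete D" and "zmod.subspace D"
  shows "uniform_discrete D"
proof -
  have "0 isolated_in D"
    using assms zmod.subspace_0 by (auto simp: discrete_def)
  then obtain e where e: "e > 0" "\<And>x. x \<in> D \<Longrightarrow> dist 0 x < e \<Longrightarrow> x = 0"
    unfolding isolated_in_dist_Ex_iff by metis
  show ?thesis
  proof (rule uniformI1[OF e(1)])
    fix x y assume "x \<in> D" "y \<in> D" "dist x y < e"
    then show "x = y"
      using e(2)[of "x - y"] zmod.subspace_diff[OF assms(2), of x y]
      by (simp add: dist_norm norm_minus_commute)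
  qed
qed

lemma finite_uniform_discrete_Int_bounded:
  fixes D :: "'a::heine_borel set"
  assumes "uniform_discrete D" and "bounded S"
  shows "finite (D \<inter> S)"
proof -
  have "finite (closure S \<inter> D)"
  proof (rule finite_not_islimpt_in_compact)
    show "compact (closure S)"
      using assms(2) by simp
    fix z
    show "\<not> z islimpt D"
      using assms(1) unfolding uniform_discrete_def by (metis discrete_imp_not_islimpt)
  qed
  then show ?thesis
    by (rule rev_finite_subset) (use closure_subset in auto)
qed

lemma discrete_subgroup_finite_index:
  fixes D :: "'a::euclidean_space set"
  assumes D: "discrete D" "zmod.subspace D" and D': "zmod.subspace D'" "D' \<subseteq> D" "D \<subseteq> span D'"
  obtains S where "finite S" "S \<subseteq> D" "\<And>x. x \<in> D \<Longrightarrow> \<exists>s\<in>S. x - s \<in> D'"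
proof -
  obtain B where B: "B \<subseteq> D'" "independent B" "D' \<subseteq> span B"
    using maximal_independent_subset[of D'] by blast
  have fin: "finite B"
    using B(2) by (rule independent_imp_finite)
  define S where "S = D \<inter> cball 0 (\<Sum>b\<in>B. norm b)"
  have "finite S"
    unfolding S_def
    by (intro finite_uniform_discrete_Int_bounded uniform_discrete_subgroup D bounded_cball)
  moreover have "\<exists>s\<in>S. x - s \<in> D'" if x: "x \<in> D" for x
  proof -
    have "x \<in> span B"
      using x D' B(3) span_mono span_span by blast
    then obtain u where u: "x = (\<Sum>b\<in>B. u b *\<^sub>R b)"
      using span_finite[OF fin] by auto
    define y where "y = (\<Sum>b\<in>B. of_int \<lfloor>u b\<rfloor> *\<^sub>R b)"
    have y: "y \<in> D'"
      unfolding y_def using B(1) by (intro zmod.subspace_sum zmod.subspace_scale D'(1)) auto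
    have "x - y = (\<Sum>b\<in>B. frac (u b) *\<^sub>R b)"
      by (simp add: u y_def frac_def scaleR_left_diff_distrib sum_subtractf)
    then have "norm (x - y) \<le> (\<Sum>b\<in>B. norm (frac (u b) *\<^sub>R b))"
      by (simp only: norm_sum)
    also have "\<dots> \<le> (\<Sum>b\<in>B. norm b)"
      by (intro sum_mono) (simp add: mult_left_le_one_le less_imp_le[OF frac_lt_1])
    finally have "x - y \<in> S"
      unfolding S_def using x y D'(2) zmod.subspace_diff[OF D(2)] by auto
    moreover have "x - (x - y) \<in> D'"
      using y by simp
    ultimately show ?thesis
      by blast
  qed
  ultimately show thesis
    using that[of S] by (auto simp: S_def)
qed

lemma discrete_subgroup_finite_exponent:
  fixes D :: "'a::euclidean_space set"
  assumes D: "discrete D" "zmod.subspace D" and D': "zmod.subspace D'" "D' \<subseteq> D" "D \<subseteq> span D'"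
  obtains N :: int where "N > 0" "\<And>x. x \<in> D \<Longrightarrow> of_int N *\<^sub>R x \<in> D'"
proof -
  obtain S where S: "finite S" "S \<subseteq> D" "\<And>x. x \<in> D \<Longrightarrow> \<exists>s\<in>S. x - s \<in> D'"
    using discrete_subgroup_finite_index[OF assms] by blast
  have "\<exists>N::int. N > 0 \<and> of_int N *\<^sub>R s \<in> D'" if s: "s \<in> S" for s
  proof -
    have "\<exists>t\<in>S. of_int (int k) *\<^sub>R s - t \<in> D'" for k
      using S s zmod.subspace_scale[OF D(2)] by blast
    then obtain r where r: "\<And>k. r k \<in> S" "\<And>k. of_int (int k) *\<^sub>R s - r k \<in> D'"
      by metis
    have "finite (range r)"
      using r(1) S(1) by (meson finite_subset image_subset_iff)
    then have "\<not> inj r"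
      using finite_imageD by fastforce
    then obtain k l where kl: "k < l" "r k = r l"
      unfolding inj_def by (metis linorder_neqE_nat)
    have "(of_int (int l) *\<^sub>R s - r l) - (of_int (int k) *\<^sub>R s - r k) \<in> D'"
      using r zmod.subspace_diff[OF D'(1)] by blast
    then have "of_int (int l - int k) *\<^sub>R s \<in> D'"
      using kl(2) by (simp add: algebra_simps)
    then show ?thesis
      using kl(1) by (intro exI[of _ "int l - int k"]) auto
  qed
  then obtain N :: "'a \<Rightarrow> int" where N: "\<And>s. s \<in> S \<Longrightarrow> N s > 0" "\<And>s. s \<in> S \<Longrightarrow> of_int (N s) *\<^sub>R s \<in> D'"
    by metis
  define M where "M = prod N S"
  show thesis
  proof (rule that[of M])
    show "M > 0"
      unfolding M_def using N(1) by (simp add: prod_pos)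
    fix x assume "x \<in> D"
    then obtain s where s: "s \<in> S" "x - s \<in> D'"
      using S(3) by blast
    have "M = prod N (S - {s}) * N s"
      unfolding M_def using S(1) s(1) by (simp add: prod.remove mult.commute)
    then have "of_int M *\<^sub>R s = of_int (prod N (S - {s})) *\<^sub>R (of_int (N s) *\<^sub>R s)"
      by simp
    also have "\<dots> \<in> D'"
      using N(2) s(1) zmod.subspace_scale[OF D'(1)] by blast
    finally have "of_int M *\<^sub>R s \<in> D'" .
    moreover have "of_int M *\<^sub>R (x - s) \<in> D'"
      using s(2) zmod.subspace_scale[OF D'(1)] by blast
    ultimately have "of_int M *\<^sub>R (x - s) + of_int M *\<^sub>R s \<in> D'"
      using zmod.subspace_add[OF D'(1)] by blast
    then show "of_int M *\<^sub>R x \<in> D'"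
      by (simp add: scaleR_diff_right)
  qed
qed

lemma subspace_imp_zmod_subspace: "subspace S \<Longrightarrow> zmod.subspace S"
  by (auto simp: zmod.subspace_def subspace_def)

lemma zmod_subspace_linear_image:
  assumes "linear f" and "zmod.subspace S"
  shows "zmod.subspace (f ` S)"
  unfolding zmod.subspace_def
proof (intro conjI ballI allI)
  show "0 \<in> f ` S"
    using linear_0[OF assms(1)] zmod.subspace_0[OF assms(2)] by (metis imageI)
  show "x + y \<in> f ` S" if "x \<in> f ` S" "y \<in> f ` S" for x y
    using that zmod.subspace_add[OF assms(2)] by (auto simp flip: linear_add[OF assms(1)])
  show "of_int c *\<^sub>R x \<in> f ` S" if "x \<in> f ` S" for c :: int and x
    using that zmod.subspace_scale[OF assms(2)] by (auto simp flip: linear_scale[OF assms(1)])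
qed

lemma zmod_span_subset_span: "zmod.span B \<subseteq> span B"
  by (intro zmod.span_minimal span_superset subspace_imp_zmod_subspace subspace_span)

lemma discrete_imp_independent:
  fixes B :: "'a::euclidean_space set"
  assumes "finite B" and B: "zmod.independent B" and "discrete (zmod.span B)"
  shows "independent B"
proof -
  obtain B' where B': "B' \<subseteq> B" "independent B'" "B \<subseteq> span B'"
    using maximal_independent_subset[of B] by blast
  have fin: "finite B'"
    using B'(2) by (rule independent_imp_finite)
  have "zmod.span B \<subseteq> span B"
    by (rule zmod_span_subset_span)
  also have "\<dots> \<subseteq> span B'"
    using B'(3) by (simp add: span_minimal)
  also have "\<dots> \<subseteq> span (zmod.span B')"
    by (intro span_mono zmod.span_superset)
  finally obtain N :: int where N: "N > 0" "\<And>x. x \<in> zmod.span B \<Longrightarrow> of_int N *\<^sub>R x \<in> zmod.span B'"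
    using discrete_subgroup_finite_exponent[OF assms(3) zmod.subspace_span zmod.subspace_span
        zmod.span_mono[OF B'(1)]] by blast
  have "b \<in> B'" if b: "b \<in> B" for b
  proof (rule ccontr)
    assume nb: "b \<notin> B'"
    have "of_int N *\<^sub>R b \<in> zmod.span B'"
      using N(2) b zmod.span_base by blast
    then obtain u :: "'a \<Rightarrow> int" where u: "of_int N *\<^sub>R b = (\<Sum>v\<in>B'. of_int (u v) *\<^sub>R v)"
      using zmod.span_finite[OF fin] by auto
    define w where "w = u(b := - N)"
    have "(\<Sum>v\<in>insert b B'. of_int (w v) *\<^sub>R v) = - (of_int N *\<^sub>R b) + (\<Sum>v\<in>B'. of_int (w v) *\<^sub>R v)"
      using fin nb by (simp add: w_def)
    also have "(\<Sum>v\<in>B'. of_int (w v) *\<^sub>R v) = (\<Sum>v\<in>B'. of_int (u v) *\<^sub>R v)"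
      using nb by (intro sum.cong) (auto simp: w_def)
    finally have "(\<Sum>v\<in>insert b B'. of_int (w v) *\<^sub>R v) = 0"
      by (simp add: u)
    then have "w b = 0"
      using zmod.independentD[OF B, of "insert b B'" w b] fin b B'(1) by auto
    then show False
      using N(1) by (simp add: w_def)
  qed
  then show ?thesis
    using B' by (metis subsetI subset_antisym)
qed

lemma complex_lattice_basis:
  fixes \<Gamma> :: "(complex^'n) set"
  assumes "complex_lattice \<Gamma>"
  obtains B where "finite B" "independent B" "span B = UNIV" "zmod.span B = \<Gamma>"
proof -
  obtain B where B: "zmod.independent B" "zmod.span B = \<Gamma>" "card B = 2 * CARD('n)" "discrete \<Gamma>"
    using assms unfolding complex_lattice_def by blast
  have fin: "finite B"
    using B(3) by (metis card_eq_0_iff mult_is_0 zero_neq_numeral zero_less_card_finite less_irrefl)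
  have ind: "independent B"
    using discrete_imp_independent fin B by blast
  have "dim (UNIV :: (complex^'n) set) = card B"
    by (simp add: B(3) mult.commute)
  then have "span B = UNIV"
    using ind card_ge_dim_independent[OF subset_UNIV ind] by auto
  then show thesis
    using that fin ind B by blast
qed

lemma
  fixes \<Gamma> :: "(complex^'n) set"
  assumes "complex_lattice \<Gamma>"
  shows complex_lattice_discrete: "discrete \<Gamma>"
    and complex_lattice_subgroup: "zmod.subspace \<Gamma>"
    and complex_lattice_span: "span \<Gamma> = UNIV"
proof -
  show "discrete \<Gamma>"
    using assms by (simp add: complex_lattice_def)
  show "zmod.subspace \<Gamma>"
    using assms by (auto simp: complex_lattice_def)
  show "span \<Gamma> = UNIV"
    using complex_lattice_basis[OF assms]
    by (metis span_mono top.extremum_uniqueI zmod.span_superset)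
qed

lemma discrete_subgroup_countable:
  fixes D :: "'a::euclidean_space set"
  assumes "discrete D" and "zmod.subspace D"
  shows "countable D"
proof -
  have "countable (D \<inter> cball 0 (real n))" for n
    by (intro countable_finite finite_uniform_discrete_Int_bounded
        uniform_discrete_subgroup assms bounded_cball)
  then have "countable (\<Union>n. D \<inter> cball 0 (real n))"
    by blast
  moreover have "D \<subseteq> (\<Union>n. D \<inter> cball 0 (real n))"
  proof
    fix x assume "x \<in> D"
    moreover obtain n where "norm x \<le> real n"
      using real_arch_simple by blast
    ultimately show "x \<in> (\<Union>n. D \<inter> cball 0 (real n))"
      by auto
  qed
  ultimately show ?thesis
    by (rule countable_subset[rotated])
qed

definition max_line_space :: "'a::real_vector set \<Rightarrow> 'a set" where
  "max_line_space C = {x. \<forall>t. t *\<^sub>R x \<in> C}"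

lemma max_line_space_subset: "max_line_space C \<subseteq> C"
  unfolding max_line_space_def by (auto dest: spec[of _ 1])

lemma subspace_max_line_space:
  assumes "zmod.subspace C"
  shows "subspace (max_line_space C)"
  using zmod.subspace_0[OF assms] zmod.subspace_add[OF assms]
  by (auto simp: subspace_def max_line_space_def scaleR_add_right)

lemma closed_subgroup_near_0:
  fixes C :: "'a::euclidean_space set"
  assumes C: "closed C" "zmod.subspace C"
  obtains e where "e > 0" "C \<inter> ball 0 e \<subseteq> max_line_space C"
proof (rule ccontr)
  assume "\<not> thesis"
  define W where "W = max_line_space C"
  have W: "subspace W" "W \<subseteq> C"
    using C subspace_max_line_space max_line_space_subset by (auto simp: W_def)
  have "\<exists>x. x \<in> C \<and> norm x < inverse (Suc k) \<and> x \<notin> W" for k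
    using \<open>\<not> thesis\<close> that[of "inverse (Suc k)"] by (fastforce simp: W_def)
  then obtain x where x: "\<And>k. x k \<in> C" "\<And>k. norm (x k) < inverse (Suc k)" "\<And>k. x k \<notin> W"
    by metis
  have "\<exists>y. y \<in> C \<and> norm y < inverse (Suc k) \<and> y \<noteq> 0 \<and> (\<forall>w\<in>W. orthogonal y w)" for k
  proof -
    obtain w y where wy: "w \<in> span W" "\<And>v. v \<in> span W \<Longrightarrow> orthogonal y v" "x k = w + y"
      using orthogonal_subspace_decomp_exists[of W "x k"] by metis
    have w: "w \<in> W"
      using wy(1) W(1) by (metis span_eq_iff)
    have "y = x k - w"
      using wy(3) by simp
    moreover have "norm (x k)^2 = norm w^2 + norm y^2"
      using norm_add_Pythagorean[of w y] wy orthogonal_commute by metis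
    then have "norm y \<le> norm (x k)"
      by (metis le_add_same_cancel2 norm_ge_zero power2_le_imp_le zero_le_power2)
    ultimately show ?thesis
      using x[of k] w W zmod.subspace_diff[OF C(2)] wy(2) span_superset[of W]
      by (intro exI[of _ y]) auto
  qed
  then obtain y where y: "\<And>k. y k \<in> C" "\<And>k. norm (y k) < inverse (Suc k)" "\<And>k. y k \<noteq> 0"
    "\<And>k w. w \<in> W \<Longrightarrow> orthogonal (y k) w"
    by metis
  define z where "z k = y k /\<^sub>R norm (y k)" for k
  have "\<forall>k. z k \<in> sphere 0 1"
    using y(3) by (simp add: z_def)
  then obtain u r where u: "u \<in> sphere 0 1" "strict_mono r" "(z \<circ> r) \<longlonglongrightarrow> u"
    using compact_sphere[of "0::'a" 1] unfolding compact_def by metis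
  have y0: "(\<lambda>k. norm (y k)) \<longlonglongrightarrow> 0"
    by (rule tendsto_sandwich[OF _ _ tendsto_const LIMSEQ_inverse_real_of_nat])
       (use y(2) in \<open>auto intro: less_imp_le eventuallyI\<close>)
  have "u \<in> W"
    unfolding W_def max_line_space_def
  proof safe
    fix t :: real
    define c where "c k = of_int \<lfloor>t / norm (y k)\<rfloor> * norm (y k)" for k
    have "\<bar>c k - t\<bar> \<le> norm (y k)" for k
    proof -
      have "c k - t = - (frac (t / norm (y k)) * norm (y k))"
        using y(3)[of k] by (simp add: c_def frac_def field_simps)
      then show ?thesis
        using frac_lt_1[of "t / norm (y k)"] by (simp add: abs_mult mult_left_le_one_le)
    qed
    then have "(\<lambda>k. c k - t) \<longlonglongrightarrow> 0"
      by (intro Lim_null_comparison[OF _ y0]) (auto intro: eventuallyI)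
    then have "c \<longlonglongrightarrow> t"
      by (simp add: LIM_zero_iff)
    then have "(c \<circ> r) \<longlonglongrightarrow> t"
      using u(2) by (rule LIMSEQ_subseq_LIMSEQ)
    then have lim: "(\<lambda>k. (c \<circ> r) k *\<^sub>R (z \<circ> r) k) \<longlonglongrightarrow> t *\<^sub>R u"
      using u(3) by (rule tendsto_scaleR)
    have "c k *\<^sub>R z k = of_int \<lfloor>t / norm (y k)\<rfloor> *\<^sub>R y k" for k
      using y(3)[of k] by (simp add: c_def z_def)
    then have "c k *\<^sub>R z k \<in> C" for k
      using zmod.subspace_scale[OF C(2)] y(1) by metis
    then show "t *\<^sub>R u \<in> C"
      using closed_sequentially[OF C(1) _ lim] by simp
  qed
  have "orthogonal (z k) u" for k
    using y(4)[OF \<open>u \<in> W\<close>] by (simp add: z_def orthogonal_def)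
  then have "(\<lambda>k. (z \<circ> r) k \<bullet> u) \<longlonglongrightarrow> 0"
    by (simp add: orthogonal_def)
  moreover have "(\<lambda>k. (z \<circ> r) k \<bullet> u) \<longlonglongrightarrow> u \<bullet> u"
    using u(3) by (intro tendsto_intros)
  ultimately have "u \<bullet> u = 0"
    using LIMSEQ_unique by blast
  then show False
    using u(1) by simp
qed

lemma closed_countable_subgroup_discrete:
  fixes C :: "'a::euclidean_space set"
  assumes C: "closed C" "zmod.subspace C" "countable C"
  shows "discrete C"
proof -
  have "u = 0" if u: "u \<in> max_line_space C" for u
  proof (rule ccontr)
    assume "u \<noteq> 0"
    then have "inj (\<lambda>t::real. t *\<^sub>R u)"
      by (simp add: inj_def)
    moreover have "countable (range (\<lambda>t::real. t *\<^sub>R u))"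
      by (rule countable_subset[OF _ C(3)]) (use u in \<open>auto simp: max_line_space_def\<close>)
    ultimately show False
      using countable_image_inj_on uncountable_UNIV_real by blast
  qed
  moreover obtain e where e: "e > 0" "C \<inter> ball 0 e \<subseteq> max_line_space C"
    using closed_subgroup_near_0[OF C(1,2)] .
  ultimately have 0: "x = 0" if "x \<in> C" "norm x < e" for x
    using that by auto
  have "uniform_discrete C"
  proof (rule uniformI1[OF e(1)])
    fix x y assume "x \<in> C" "y \<in> C" "dist x y < e"
    then show "x = y"
      using 0[of "x - y"] zmod.subspace_diff[OF C(2)] by (auto simp: dist_norm)
  qed
  then show ?thesis
    by (rule uniform_discrete_imp_discrete)
qed

section \<open>Closures of subgroups of a torus\<close>

lemma torus_proj_eq_iff:
  assumes "zmod.subspace \<Gamma>"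
  shows "torus_proj \<Gamma> x = torus_proj \<Gamma> y \<longleftrightarrow> x - y \<in> \<Gamma>"
proof
  assume "torus_proj \<Gamma> x = torus_proj \<Gamma> y"
  moreover have "x \<in> torus_proj \<Gamma> x"
    using zmod.subspace_0[OF assms] by (force simp: torus_proj_eq)
  ultimately show "x - y \<in> \<Gamma>"
    by (auto simp: torus_proj_eq)
next
  have *: "torus_proj \<Gamma> x \<subseteq> torus_proj \<Gamma> y" if "x - y \<in> \<Gamma>" for x y
  proof
    fix z assume "z \<in> torus_proj \<Gamma> x"
    then obtain g where "g \<in> \<Gamma>" "z = (g + (x - y)) + y"
      by (auto simp: torus_proj_eq)
    then show "z \<in> torus_proj \<Gamma> y"
      using zmod.subspace_add[OF assms _ that] unfolding torus_proj_eq by blast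
  qed
  assume "x - y \<in> \<Gamma>"
  moreover from this have "y - x \<in> \<Gamma>"
    using zmod.subspace_neg[OF assms] by fastforce
  ultimately show "torus_proj \<Gamma> x = torus_proj \<Gamma> y"
    using * by blast
qed

lemma torus_mult:
  assumes "zmod.subspace \<Gamma>"
  shows "torus_proj \<Gamma> x \<otimes>\<^bsub>torus \<Gamma>\<^esub> torus_proj \<Gamma> y = torus_proj \<Gamma> (x + y)"
proof -
  have "torus_proj \<Gamma> x \<otimes>\<^bsub>torus \<Gamma>\<^esub> torus_proj \<Gamma> y = {a + b |a b. a \<in> torus_proj \<Gamma> x \<and> b \<in> torus_proj \<Gamma> y}"
    by (auto simp: torus_def FactGroup_def set_mult_def vector_group_def)
  also have "\<dots> = torus_proj \<Gamma> (x + y)"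
  proof safe
    fix a b assume "a \<in> torus_proj \<Gamma> x" "b \<in> torus_proj \<Gamma> y"
    then obtain g h where "g \<in> \<Gamma>" "h \<in> \<Gamma>" "a + b = (g + h) + (x + y)"
      by (auto simp: torus_proj_eq algebra_simps)
    then show "a + b \<in> torus_proj \<Gamma> (x + y)"
      using zmod.subspace_add[OF assms] unfolding torus_proj_eq by blast
  next
    fix z assume "z \<in> torus_proj \<Gamma> (x + y)"
    then obtain g where "g \<in> \<Gamma>" "z = (g + x) + (0 + y)"
      by (auto simp: torus_proj_eq algebra_simps)
    then show "\<exists>a b. z = a + b \<and> a \<in> torus_proj \<Gamma> x \<and> b \<in> torus_proj \<Gamma> y"
      using zmod.subspace_0[OF assms] unfolding torus_proj_eq by blast
  qed
  finally show ?thesis .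
qed

lemma torus_one: "\<one>\<^bsub>torus \<Gamma>\<^esub> = torus_proj \<Gamma> 0"
  by (simp add: torus_def FactGroup_def torus_proj_eq)

lemma closedin_torus_topology:
  "closedin (torus_topology \<Gamma>) K \<longleftrightarrow> K \<subseteq> carrier (torus \<Gamma>) \<and> closed (torus_proj \<Gamma> -` K)"
proof -
  have "torus_proj \<Gamma> -` (carrier (torus \<Gamma>) - K) = - (torus_proj \<Gamma> -` K)"
    by (auto simp: carrier_torus)
  then show ?thesis
    by (auto simp: closedin_def topspace_torus_topology openin_torus_topology closed_def)
qed

lemma scaleR_eq_of_real_scale:
  fixes x :: "complex^'n"
  shows "c *\<^sub>R x = complex_of_real c *s x"
  by (simp add: vec_eq_iff complex_eq_iff)

lemma vec_subspace_imp_subspace: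
  fixes V :: "(complex^'n) set"
  assumes "vec.subspace V"
  shows "subspace V"
  using assms by (auto simp: vec.subspace_def subspace_def scaleR_eq_of_real_scale)

lemma clinear_imp_linear:
  fixes A :: "complex^'m \<Rightarrow> complex^'k"
  assumes "Vector_Spaces.linear (*s) (*s) A"
  shows "linear A"
proof -
  interpret A: Vector_Spaces.linear "(*s)" "(*s)" A
    by (fact assms)
  show ?thesis
    by (rule linearI) (simp_all add: scaleR_eq_of_real_scale A.add A.scale)
qed

lemma zmod_subspace_closure:
  fixes C :: "'a::real_normed_vector set"
  assumes "zmod.subspace C"
  shows "zmod.subspace (closure C)"
  unfolding zmod.subspace_def
proof (intro conjI ballI allI)
  show "0 \<in> closure C"
    using zmod.subspace_0[OF assms] closure_subset by blast
next
  fix x y assume "x \<in> closure C" "y \<in> closure C"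
  then obtain f g where "\<And>n. f n \<in> C" "f \<longlonglongrightarrow> x" "\<And>n. g n \<in> C" "g \<longlonglongrightarrow> y"
    unfolding closure_sequential by blast
  then show "x + y \<in> closure C"
    unfolding closure_sequential
    by (intro exI[of _ "\<lambda>n. f n + g n"]) (auto intro!: tendsto_intros zmod.subspace_add[OF assms])
next
  fix c :: int and x assume "x \<in> closure C"
  then obtain f where "\<And>n. f n \<in> C" "f \<longlonglongrightarrow> x"
    unfolding closure_sequential by blast
  then show "of_int c *\<^sub>R x \<in> closure C"
    unfolding closure_sequential
    by (intro exI[of _ "\<lambda>n. of_int c *\<^sub>R f n"]) (auto intro!: tendsto_intros zmod.subspace_scale[OF assms])
qed

definition saturation :: "'a::ab_group_add set \<Rightarrow> 'a set \<Rightarrow> 'a set" where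
  "saturation \<Gamma> V = {x. \<exists>v\<in>V. x - v \<in> \<Gamma>}"

lemma vimage_torus_proj_image:
  assumes "zmod.subspace \<Gamma>"
  shows "torus_proj \<Gamma> -` (torus_proj \<Gamma> ` V) = saturation \<Gamma> V"
  by (auto simp: saturation_def torus_proj_eq_iff[OF assms])

lemma zmod_subspace_saturation:
  fixes \<Gamma> :: "'a::real_vector set"
  assumes "zmod.subspace \<Gamma>" and "zmod.subspace V"
  shows "zmod.subspace (saturation \<Gamma> V)"
  unfolding zmod.subspace_def
proof (intro conjI ballI allI)
  show "0 \<in> saturation \<Gamma> V"
    using assms[THEN zmod.subspace_0] by (force simp: saturation_def)
next
  fix x y assume "x \<in> saturation \<Gamma> V" "y \<in> saturation \<Gamma> V"
  then obtain v w where "v \<in> V" "x - v \<in> \<Gamma>" "w \<in> V" "y - w \<in> \<Gamma>"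
    by (auto simp: saturation_def)
  then show "x + y \<in> saturation \<Gamma> V"
    unfolding saturation_def using assms[THEN zmod.subspace_add]
    by (metis (mono_tags, lifting) add_diff_add mem_Collect_eq)
next
  fix c :: int and x assume "x \<in> saturation \<Gamma> V"
  then obtain v where "v \<in> V" "x - v \<in> \<Gamma>"
    by (auto simp: saturation_def)
  then show "of_int c *\<^sub>R x \<in> saturation \<Gamma> V"
    unfolding saturation_def using assms[THEN zmod.subspace_scale]
    by (metis (mono_tags, lifting) scaleR_diff_right mem_Collect_eq)
qed

lemma subset_saturation: "0 \<in> \<Gamma> \<Longrightarrow> V \<subseteq> saturation \<Gamma> V"
  by (auto simp: saturation_def intro!: bexI)

lemma lattice_subset_saturation: "0 \<in> V \<Longrightarrow> \<Gamma> \<subseteq> saturation \<Gamma> V"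
  by (auto simp: saturation_def intro: bexI[of _ 0])

lemma closure_of_torus_proj_image:
  fixes \<Gamma> :: "(complex^'n) set"
  assumes \<Gamma>: "zmod.subspace \<Gamma>" and V: "zmod.subspace V"
  shows "torus_topology \<Gamma> closure_of (torus_proj \<Gamma> ` V) = torus_proj \<Gamma> ` closure (saturation \<Gamma> V)"
    and "torus_proj \<Gamma> -` (torus_proj \<Gamma> ` closure (saturation \<Gamma> V)) = closure (saturation \<Gamma> V)"
proof -
  define C where "C = closure (saturation \<Gamma> V)"
  have C: "zmod.subspace C" "saturation \<Gamma> V \<subseteq> C"
    unfolding C_def by (intro zmod_subspace_closure zmod_subspace_saturation assms closure_subset)+
  have sub: "\<Gamma> \<subseteq> C" "V \<subseteq> C"
    using C(2) lattice_subset_saturation[of V \<Gamma>] subset_saturation[of \<Gamma> V]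
      zmod.subspace_0[OF V] zmod.subspace_0[OF \<Gamma>] by auto
  have "x \<in> C" if "v \<in> C" "x - v \<in> \<Gamma>" for x v
    using zmod.subspace_add[OF C(1), of v "x - v"] that sub by auto
  then have "saturation \<Gamma> C \<subseteq> C"
    by (auto simp: saturation_def)
  then have sat: "saturation \<Gamma> C = C"
    using subset_saturation[OF zmod.subspace_0[OF \<Gamma>]] by blast
  then show pre: "torus_proj \<Gamma> -` (torus_proj \<Gamma> ` closure (saturation \<Gamma> V)) = closure (saturation \<Gamma> V)"
    by (simp add: vimage_torus_proj_image \<Gamma> C_def)
  show "torus_topology \<Gamma> closure_of (torus_proj \<Gamma> ` V) = torus_proj \<Gamma> ` closure (saturation \<Gamma> V)"
  proof
    have "closedin (torus_topology \<Gamma>) (torus_proj \<Gamma> ` C)"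
      using pre by (auto simp: closedin_torus_topology carrier_torus C_def)
    then show "torus_topology \<Gamma> closure_of (torus_proj \<Gamma> ` V) \<subseteq> torus_proj \<Gamma> ` closure (saturation \<Gamma> V)"
      using sub(2) by (intro closure_of_minimal) (auto simp: C_def)
    define K where "K = torus_topology \<Gamma> closure_of (torus_proj \<Gamma> ` V)"
    have "closed (torus_proj \<Gamma> -` K)"
      by (rule closedin_torus_topology[THEN iffD1, THEN conjunct2]) (simp add: K_def)
    moreover have "torus_proj \<Gamma> ` V \<subseteq> K"
      unfolding K_def by (rule closure_of_subset) (auto simp: topspace_torus_topology carrier_torus)
    then have "saturation \<Gamma> V \<subseteq> torus_proj \<Gamma> -` K"
      unfolding vimage_torus_proj_image[OF \<Gamma>, symmetric] by (rule vimage_mono)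
    ultimately have "closure (saturation \<Gamma> V) \<subseteq> torus_proj \<Gamma> -` K"
      by (rule closure_minimal[rotated])
    then show "torus_proj \<Gamma> ` closure (saturation \<Gamma> V) \<subseteq> torus_topology \<Gamma> closure_of (torus_proj \<Gamma> ` V)"
      by (auto simp: K_def)
  qed
qed

lemma complex_subtorus_closure_of_iff:
  fixes \<Gamma> :: "(complex^'n) set"
  assumes \<Gamma>: "zmod.subspace \<Gamma>" and V: "zmod.subspace V"
  shows "complex_subtorus \<Gamma> (torus_topology \<Gamma> closure_of (torus_proj \<Gamma> ` V)) \<longleftrightarrow>
    (\<exists>W. vec.subspace W \<and> closure (saturation \<Gamma> V) = saturation \<Gamma> W)"
proof -
  have "torus_proj \<Gamma> ` closure (saturation \<Gamma> V) = torus_proj \<Gamma> ` W \<longleftrightarrow>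
      closure (saturation \<Gamma> V) = saturation \<Gamma> W" for W
  proof
    assume "torus_proj \<Gamma> ` closure (saturation \<Gamma> V) = torus_proj \<Gamma> ` W"
    then show "closure (saturation \<Gamma> V) = saturation \<Gamma> W"
      using closure_of_torus_proj_image(2)[OF assms] vimage_torus_proj_image[OF \<Gamma>] by metis
  next
    assume "closure (saturation \<Gamma> V) = saturation \<Gamma> W"
    moreover have "torus_proj \<Gamma> ` saturation \<Gamma> W = torus_proj \<Gamma> ` W"
      unfolding vimage_torus_proj_image[OF \<Gamma>, symmetric] by auto
    ultimately show "torus_proj \<Gamma> ` closure (saturation \<Gamma> V) = torus_proj \<Gamma> ` W"
      by simp
  qed
  moreover have "closedin (torus_topology \<Gamma>) (torus_proj \<Gamma> ` closure (saturation \<Gamma> V))"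
    unfolding closure_of_torus_proj_image(1)[OF assms, symmetric] by (rule closedin_closure_of)
  ultimately show ?thesis
    by (simp add: complex_subtorus_def connected_complex_Lie_subgroup_def
        closure_of_torus_proj_image(1)[OF assms])
qed

lemma closure_saturation_of_stable:
  fixes \<Gamma> :: "(complex^'n) set"
  assumes \<Gamma>: "zmod.subspace \<Gamma>" and V: "vec.subspace V"
    and \<alpha>: "Im \<alpha> \<noteq> 0" "\<And>g. g \<in> \<Gamma> \<Longrightarrow> \<alpha> *s g \<in> \<Gamma>"
  shows "\<exists>W. vec.subspace W \<and> closure (saturation \<Gamma> V) = saturation \<Gamma> W"
proof -
  define C where "C = closure (saturation \<Gamma> V)"
  define W where "W = max_line_space C"
  note V' = vec_subspace_imp_subspace[OF V]
  have zV: "zmod.subspace V"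
    using V' by (rule subspace_imp_zmod_subspace)
  have C: "zmod.subspace C" "closed C"
    unfolding C_def by (auto intro: zmod_subspace_closure zmod_subspace_saturation \<Gamma> zV)
  have W: "subspace W" "W \<subseteq> C"
    using C subspace_max_line_space max_line_space_subset by (auto simp: W_def)
  have sub: "\<Gamma> \<subseteq> C" "V \<subseteq> C"
    using closure_subset[of "saturation \<Gamma> V"] lattice_subset_saturation[of V \<Gamma>] subset_saturation[of \<Gamma> V]
      zmod.subspace_0[OF zV] zmod.subspace_0[OF \<Gamma>] by (auto simp: C_def)
  have \<alpha>C: "\<alpha> *s x \<in> C" if "x \<in> C" for x
  proof -
    have "\<alpha> *s x \<in> saturation \<Gamma> V" if "x \<in> saturation \<Gamma> V" for x
    proof -
      obtain v where "v \<in> V" "x - v \<in> \<Gamma>"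
        using \<open>x \<in> saturation \<Gamma> V\<close> by (auto simp: saturation_def)
      then have "\<alpha> *s v \<in> V" "\<alpha> *s x - \<alpha> *s v \<in> \<Gamma>"
        using \<alpha>(2) vec.subspace_scale[OF V] by (metis vec.scale_right_diff_distrib)+
      then show ?thesis
        by (auto simp: saturation_def)
    qed
    then have "(\<lambda>x. \<alpha> *s x) ` saturation \<Gamma> V \<subseteq> C"
      using closure_subset by (auto simp: C_def)
    moreover have "continuous_on S (\<lambda>x::complex^'n. \<alpha> *s x)" for S
      unfolding vector_scalar_mult_def by (intro continuous_intros)
    ultimately have "(\<lambda>x. \<alpha> *s x) ` closure (saturation \<Gamma> V) \<subseteq> C"
      using C(2) by (intro image_closure_subset)
    then show ?thesis
      using that by (auto simp: C_def)
  qed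
  have "\<alpha> *s x \<in> W" if "x \<in> W" for x
  proof -
    have "t *\<^sub>R (\<alpha> *s x) = \<alpha> *s (t *\<^sub>R x)" for t
      by (simp add: vec_eq_iff)
    then show ?thesis
      using that \<alpha>C by (auto simp: W_def max_line_space_def)
  qed
  moreover have "c *s x = (Re c - Im c / Im \<alpha> * Re \<alpha>) *\<^sub>R x + (Im c / Im \<alpha>) *\<^sub>R (\<alpha> *s x)" for c and x :: "complex^'n"
    using \<alpha>(1) by (auto simp: vec_eq_iff complex_eq_iff field_simps)
  ultimately have "vec.subspace W"
    using W(1) unfolding vec.subspace_def by (metis subspace_add subspace_scale subspace_0)
  moreover have "C = saturation \<Gamma> W"
  proof
    show "saturation \<Gamma> W \<subseteq> C"
    proof
      fix x assume "x \<in> saturation \<Gamma> W"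
      then obtain w where "w \<in> W" "x - w \<in> \<Gamma>"
        by (auto simp: saturation_def)
      then have "w + (x - w) \<in> C"
        using W(2) sub(1) by (intro zmod.subspace_add[OF C(1)]) auto
      then show "x \<in> C"
        by simp
    qed
    obtain e where e: "e > 0" "C \<inter> ball 0 e \<subseteq> W"
      using closed_subgroup_near_0[OF C(2,1)] by (auto simp: W_def)
    show "C \<subseteq> saturation \<Gamma> W"
    proof
      fix x assume x: "x \<in> C"
      then obtain y where y: "y \<in> saturation \<Gamma> V" "dist y x < e"
        using e(1) unfolding C_def closure_approachable by blast
      then obtain v where v: "v \<in> V" "y - v \<in> \<Gamma>"
        by (auto simp: saturation_def)
      have "y \<in> C"
        using y(1) closure_subset by (auto simp: C_def)
      then have "x - y \<in> W"
        using e(2) y(2) zmod.subspace_diff[OF C(1) x] by (auto simp: dist_norm norm_minus_commute)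
      moreover have "v \<in> W"
        using v(1) sub(2) subspace_scale[OF V'] by (auto simp: W_def max_line_space_def)
      ultimately have "x - y + v \<in> W"
        using W(1) subspace_add by blast
      moreover have "x - (x - y + v) \<in> \<Gamma>"
        using v(2) by simp
      ultimately show "x \<in> saturation \<Gamma> W"
        unfolding saturation_def by blast
    qed
  qed
  ultimately show ?thesis
    by (auto simp: C_def)
qed

section \<open>Homomorphisms of tori and their lifts\<close>

lemma linear_induces_holomorphic_hom:
  fixes A :: "complex^'m \<Rightarrow> complex^'k"
  assumes A: "Vector_Spaces.linear (*s) (*s) A" and \<Gamma>: "zmod.subspace \<Gamma>" and \<Gamma>': "zmod.subspace \<Gamma>'"
    and sub: "\<And>g. g \<in> \<Gamma> \<Longrightarrow> A g \<in> \<Gamma>'"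
  obtains \<phi> where "\<phi> \<in> holomorphic_hom \<Gamma> \<Gamma>'" "\<And>x. \<phi> (torus_proj \<Gamma> x) = torus_proj \<Gamma>' (A x)"
proof -
  define \<phi> where "\<phi> X = torus_proj \<Gamma>' (A (SOME x. torus_proj \<Gamma> x = X))" for X
  note lin = clinear_imp_linear[OF A]
  have \<phi>: "\<phi> (torus_proj \<Gamma> x) = torus_proj \<Gamma>' (A x)" for x
  proof -
    define y where "y = (SOME y. torus_proj \<Gamma> y = torus_proj \<Gamma> x)"
    have "torus_proj \<Gamma> y = torus_proj \<Gamma> x"
      unfolding y_def by (rule someI[of _ x]) simp
    then have "A y - A x \<in> \<Gamma>'"
      using sub[of "y - x"] by (simp add: torus_proj_eq_iff[OF \<Gamma>] linear_diff[OF lin])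
    then show ?thesis
      by (simp add: \<phi>_def y_def torus_proj_eq_iff[OF \<Gamma>'])
  qed
  have "\<phi> \<in> hom (torus \<Gamma>) (torus \<Gamma>')"
    by (rule homI) (auto simp: carrier_torus torus_mult \<Gamma> \<Gamma>' \<phi> linear_add[OF lin])
  moreover have "holomorphic_vec_on A UNIV"
    unfolding holomorphic_vec_on_def
    using A lin by (auto intro!: exI[of _ A] bounded_linear_imp_has_derivative simp: linear_conv_bounded_linear)
  then have "holomorphic_torus_map \<Gamma> \<Gamma>' \<phi>"
    unfolding holomorphic_torus_map_def using \<phi> by (intro allI exI[of _ UNIV] exI[of _ A]) auto
  ultimately show thesis
    using that \<phi> by (simp add: holomorphic_hom_def)
qed

lemma holomorphic_hom_lift:
  fixes \<Gamma> :: "(complex^'m) set" and \<Gamma>' :: "(complex^'k) set"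
  assumes \<phi>: "\<phi> \<in> holomorphic_hom \<Gamma> \<Gamma>'"
    and \<Gamma>: "zmod.subspace \<Gamma>" and \<Gamma>': "zmod.subspace \<Gamma>'" "discrete \<Gamma>'"
  obtains A where "Vector_Spaces.linear (*s) (*s) A" "\<And>x. \<phi> (torus_proj \<Gamma> x) = torus_proj \<Gamma>' (A x)"
    "\<And>g. g \<in> \<Gamma> \<Longrightarrow> A g \<in> \<Gamma>'"
proof -
  have hom: "\<phi> \<in> hom (torus \<Gamma>) (torus \<Gamma>')"
    using \<phi> by (simp add: holomorphic_hom_def)
  have \<phi>_add: "\<phi> (torus_proj \<Gamma> (x + y)) = torus_proj \<Gamma>' (a + b)"
    if "\<phi> (torus_proj \<Gamma> x) = torus_proj \<Gamma>' a" "\<phi> (torus_proj \<Gamma> y) = torus_proj \<Gamma>' b" for x y a b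
  proof -
    have "\<phi> (torus_proj \<Gamma> x \<otimes>\<^bsub>torus \<Gamma>\<^esub> torus_proj \<Gamma> y) =
        \<phi> (torus_proj \<Gamma> x) \<otimes>\<^bsub>torus \<Gamma>'\<^esub> \<phi> (torus_proj \<Gamma> y)"
      using hom by (intro hom_mult) (auto simp: carrier_torus)
    then show ?thesis
      using that by (simp add: torus_mult \<Gamma> \<Gamma>')
  qed
  obtain U F where U: "open U" "0 \<in> U" "holomorphic_vec_on F U"
    and \<phi>F: "\<And>u. u \<in> U \<Longrightarrow> \<phi> (torus_proj \<Gamma> u) = torus_proj \<Gamma>' (F u)"
    using \<phi> unfolding holomorphic_hom_def holomorphic_torus_map_def by blast
  obtain A where A: "(F has_derivative A) (at 0)" "Vector_Spaces.linear (*s) (*s) A"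
    using U unfolding holomorphic_vec_on_def by blast
  note lin = clinear_imp_linear[OF A(2)]
  have "\<phi> (torus_proj \<Gamma> (0 + 0)) = torus_proj \<Gamma>' (F 0 + F 0)"
    using \<phi>F U(2) by (intro \<phi>_add)
  then have F0: "F 0 \<in> \<Gamma>'"
    using \<phi>F[OF U(2)] zmod.subspace_neg[OF \<Gamma>'(1)] by (fastforce simp: torus_proj_eq_iff[OF \<Gamma>'(1)])
  define G where "G u = F u - F 0" for u
  have \<phi>G: "\<phi> (torus_proj \<Gamma> u) = torus_proj \<Gamma>' (G u)" if "u \<in> U" for u
    using \<phi>F[OF that] F0 by (simp add: G_def torus_proj_eq_iff[OF \<Gamma>'(1)])
  obtain e where e: "e > 0" "\<And>x. x \<in> \<Gamma>' \<Longrightarrow> norm x < e \<Longrightarrow> x = 0"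
    using uniform_discrete_subgroup[OF \<Gamma>'(2,1)] zmod.subspace_0[OF \<Gamma>'(1)]
    unfolding uniform_discrete_def by (metis dist_0_norm dist_commute)
  have "isCont F 0"
    using A(1) by (rule has_derivative_continuous)
  then obtain d1 where d1: "d1 > 0" "\<And>u. norm u < d1 \<Longrightarrow> norm (G u) < e / 3"
    using e(1) unfolding continuous_at_eps_delta dist_norm G_def
    by (metis diff_zero divide_pos_pos zero_less_numeral)
  obtain d2 where d2: "d2 > 0" "ball 0 d2 \<subseteq> U"
    using U open_contains_ball by blast
  define d where "d = min d1 d2"
  have d: "d > 0" "\<And>u. norm u < d \<Longrightarrow> norm (G u) < e / 3" "\<And>u. norm u < d \<Longrightarrow> u \<in> U"
    using d1 d2 by (auto simp: d_def)
  \<comment> \<open>Homomorphy forces \<open>G (2 v) - 2 G v \<in> \<Gamma>'\<close>, and this vector is too short to be nonzero.\<close>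
  have G_double: "G u = 2 *\<^sub>R G (u /\<^sub>R 2)" if "norm u < d" for u
  proof -
    define v where "v = u /\<^sub>R 2"
    have "u = v + v"
      by (simp add: v_def flip: scaleR_2)
    moreover have "norm u < d * 2"
      using that norm_ge_zero[of u] by linarith
    ultimately have v: "norm v < d" "u = v + v"
      by (simp_all add: v_def)
    have "\<phi> (torus_proj \<Gamma> (v + v)) = torus_proj \<Gamma>' (G v + G v)"
      using \<phi>G d(3) v(1) by (intro \<phi>_add) auto
    then have "G u - (G v + G v) \<in> \<Gamma>'"
      using \<phi>G d(3) that v(2) by (simp add: torus_proj_eq_iff[OF \<Gamma>'(1)])
    moreover have "norm (G u - (G v + G v)) \<le> norm (G u) + (norm (G v) + norm (G v))"
      using norm_triangle_ineq4 norm_triangle_ineq by (metis add_left_mono order_trans)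
    then have "norm (G u - (G v + G v)) < e"
      using d(2)[OF that] d(2)[OF v(1)] by linarith
    ultimately have "G u - (G v + G v) = 0"
      using e(2) by blast
    then show ?thesis
      by (simp add: scaleR_2 v_def)
  qed
  have G_power: "G u = 2 ^ k *\<^sub>R G (u /\<^sub>R 2 ^ k)" if "norm u < d" for u k
  proof (induction k)
    case (Suc k)
    have "norm (u /\<^sub>R 2 ^ k) \<le> norm u"
      by (simp add: mult_left_le_one_le inverse_le_1_iff)
    also have "\<dots> < d"
      by (fact that)
    finally have "G (u /\<^sub>R 2 ^ k) = 2 *\<^sub>R G (u /\<^sub>R 2 ^ k /\<^sub>R 2)"
      by (rule G_double)
    then show ?case
      using Suc by (simp add: mult.commute)
  qed simp
  have GA: "G u = A u" if u: "norm u < d" for u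
  proof -
    have le: "norm (G u - A u) \<le> \<epsilon> * norm u" if "\<epsilon> > 0" for \<epsilon>
    proof -
      have "\<forall>\<epsilon>>0. \<exists>\<delta>>0. \<forall>y. norm y < \<delta> \<longrightarrow> norm (G y - A y) \<le> \<epsilon> * norm y"
        using A(1) unfolding has_derivative_at_alt G_def by simp
      then obtain \<delta> where \<delta>: "\<delta> > 0" "\<And>y. norm y < \<delta> \<Longrightarrow> norm (G y - A y) \<le> \<epsilon> * norm y"
        using \<open>\<epsilon> > 0\<close> by blast
      obtain k where k: "norm u / \<delta> < 2 ^ k"
        using real_arch_pow[of 2 "norm u / \<delta>"] by auto
      have "norm (u /\<^sub>R 2 ^ k) < \<delta>"
        using k \<delta>(1) by (simp add: field_simps)
      from \<delta>(2)[OF this] have "norm (G (u /\<^sub>R 2 ^ k) - A (u /\<^sub>R 2 ^ k)) \<le> \<epsilon> * norm u / 2 ^ k"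
        by (simp add: field_simps)
      moreover have "G u - A u = 2 ^ k *\<^sub>R (G (u /\<^sub>R 2 ^ k) - A (u /\<^sub>R 2 ^ k))"
        using G_power[OF u, of k] by (simp add: scaleR_diff_right linear_scale[OF lin])
      then have "norm (G u - A u) = 2 ^ k * norm (G (u /\<^sub>R 2 ^ k) - A (u /\<^sub>R 2 ^ k))"
        by (metis norm_scaleR abs_of_nonneg zero_le_numeral zero_le_power)
      ultimately show ?thesis
        by (simp add: pos_le_divide_eq mult.commute)
    qed
    have "norm (G u - A u) \<le> 0 + \<epsilon>" if "\<epsilon> > 0" for \<epsilon>
    proof -
      have "norm u + 1 > 0"
        by (simp add: add_nonneg_pos)
      then have "norm (G u - A u) \<le> \<epsilon> / (norm u + 1) * norm u"
        using that by (intro le) simp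
      also have "\<dots> \<le> \<epsilon>"
        using that by (simp add: divide_le_eq add_nonneg_pos)
      finally show ?thesis
        by simp
    qed
    then have "norm (G u - A u) \<le> 0"
      by (rule field_le_epsilon)
    then show ?thesis
      by simp
  qed
  have \<phi>A: "\<phi> (torus_proj \<Gamma> x) = torus_proj \<Gamma>' (A x)" for x
  proof -
    obtain n where n: "norm x / d < real n"
      using reals_Archimedean2 by blast
    then have n0: "real n > 0"
      using d(1) by (meson divide_nonneg_pos le_less_trans norm_ge_zero)
    define u where "u = x /\<^sub>R real n"
    have u: "norm u < d" "x = real n *\<^sub>R u"
      using n n0 d(1) by (auto simp: u_def field_simps)
    have 0: "\<phi> (torus_proj \<Gamma> 0) = torus_proj \<Gamma>' (A 0)"
      using \<phi>G[OF U(2)] by (simp add: G_def linear_0[OF lin])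
    have "\<phi> (torus_proj \<Gamma> (real k *\<^sub>R u)) = torus_proj \<Gamma>' (A (real k *\<^sub>R u))" for k
    proof (induction k)
      case (Suc k)
      have "\<phi> (torus_proj \<Gamma> u) = torus_proj \<Gamma>' (A u)"
        using GA[OF u(1)] \<phi>G d(3)[OF u(1)] by simp
      from \<phi>_add[OF Suc this] show ?case
        by (simp add: linear_add[OF lin, symmetric] algebra_simps)
    qed (use 0 in simp)
    then show ?thesis
      using u(2) by simp
  qed
  moreover have "A g \<in> \<Gamma>'" if "g \<in> \<Gamma>" for g
  proof -
    have "torus_proj \<Gamma> g = torus_proj \<Gamma> 0"
      using that by (simp add: torus_proj_eq_iff[OF \<Gamma>])
    then have "torus_proj \<Gamma>' (A g) = torus_proj \<Gamma>' (A 0)"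
      using \<phi>A by metis
    then show ?thesis
      by (simp add: torus_proj_eq_iff[OF \<Gamma>'(1)] linear_0[OF lin])
  qed
  ultimately show thesis
    using that A(2) by blast
qed

lemma isogeny_lift:
  fixes \<Gamma> \<Gamma>' :: "(complex^'n) set"
  assumes iso: "isogeny \<Gamma> \<Gamma>' \<phi>"
    and \<Gamma>: "zmod.subspace \<Gamma>" "discrete \<Gamma>" and \<Gamma>': "zmod.subspace \<Gamma>'" "discrete \<Gamma>'"
  obtains A where "Vector_Spaces.linear (*s) (*s) A" "inj A" "\<And>g. g \<in> \<Gamma> \<Longrightarrow> A g \<in> \<Gamma>'"
proof -
  have \<phi>: "\<phi> \<in> holomorphic_hom \<Gamma> \<Gamma>'" "finite (kernel (torus \<Gamma>) (torus \<Gamma>') \<phi>)"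
    using iso by (auto simp: isogeny_def)
  obtain A where A: "Vector_Spaces.linear (*s) (*s) A" "\<And>x. \<phi> (torus_proj \<Gamma> x) = torus_proj \<Gamma>' (A x)"
    "\<And>g. g \<in> \<Gamma> \<Longrightarrow> A g \<in> \<Gamma>'"
    using holomorphic_hom_lift[OF \<phi>(1) \<Gamma>(1) \<Gamma>'] by blast
  note lin = clinear_imp_linear[OF A(1)]
  obtain e where e: "e > 0" "\<And>x y. x \<in> \<Gamma> \<Longrightarrow> y \<in> \<Gamma> \<Longrightarrow> dist x y < e \<Longrightarrow> x = y"
    using uniform_discrete_subgroup[OF \<Gamma>(2,1)] unfolding uniform_discrete_def by metis
  have "v = 0" if v: "A v = 0" for v
  proof (rule ccontr)
    assume "v \<noteq> 0"
    define \<delta> where "\<delta> = e / norm v"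
    have "inj_on (\<lambda>t. torus_proj \<Gamma> (t *\<^sub>R v)) {0<..<\<delta>}"
    proof (rule inj_onI)
      fix s t assume st: "s \<in> {0<..<\<delta>}" "t \<in> {0<..<\<delta>}" "torus_proj \<Gamma> (s *\<^sub>R v) = torus_proj \<Gamma> (t *\<^sub>R v)"
      then have "(s - t) *\<^sub>R v \<in> \<Gamma>"
        by (simp add: torus_proj_eq_iff[OF \<Gamma>(1)] scaleR_diff_left)
      moreover have "norm ((s - t) *\<^sub>R v) < e"
      proof -
        have "\<bar>s - t\<bar> < \<delta>"
          using st by auto
        then show ?thesis
          using \<open>v \<noteq> 0\<close> by (simp add: \<delta>_def pos_less_divide_eq)
      qed
      ultimately have "(s - t) *\<^sub>R v = 0"
        using e(2)[of "(s - t) *\<^sub>R v" 0] zmod.subspace_0[OF \<Gamma>(1)] by auto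
      then show "s = t"
        using \<open>v \<noteq> 0\<close> by simp
    qed
    moreover have "(\<lambda>t. torus_proj \<Gamma> (t *\<^sub>R v)) ` {0<..<\<delta>} \<subseteq> kernel (torus \<Gamma>) (torus \<Gamma>') \<phi>"
      by (auto simp: kernel_def carrier_torus A(2) linear_scale[OF lin] v torus_one)
    ultimately have "finite {0<..<\<delta>}"
      using \<phi>(2) by (meson finite_imageD finite_subset)
    moreover have "\<delta> > 0"
      using e(1) \<open>v \<noteq> 0\<close> by (simp add: \<delta>_def)
    ultimately show False
      by (simp add: infinite_Ioo)
  qed
  then have "inj A"
    by (simp add: linear_injective_0[OF lin])
  then show thesis
    using that A by blast
qed

lemma linear_induces_isogeny:
  fixes A :: "complex^'n \<Rightarrow> complex^'n"
  assumes A: "Vector_Spaces.linear (*s) (*s) A" "inj A"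
    and \<Gamma>: "zmod.subspace \<Gamma>" "span \<Gamma> = UNIV" and \<Gamma>': "zmod.subspace \<Gamma>'" "discrete \<Gamma>'"
    and sub: "\<And>g. g \<in> \<Gamma> \<Longrightarrow> A g \<in> \<Gamma>'"
  shows "\<exists>\<phi>. isogeny \<Gamma> \<Gamma>' \<phi>"
proof -
  note lin = clinear_imp_linear[OF A(1)]
  have surj: "surj A"
    using lin A(2) by (rule linear_injective_imp_surjective) simp
  obtain \<phi> where \<phi>: "\<phi> \<in> holomorphic_hom \<Gamma> \<Gamma>'" "\<And>x. \<phi> (torus_proj \<Gamma> x) = torus_proj \<Gamma>' (A x)"
    using linear_induces_holomorphic_hom[OF A(1) \<Gamma>(1) \<Gamma>'(1) sub] by blast
  have "\<Gamma>' \<subseteq> span (A ` \<Gamma>)"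
    by (simp add: span_linear_image[OF lin] \<Gamma>(2) surj)
  then obtain S where S: "finite S" "\<And>x. x \<in> \<Gamma>' \<Longrightarrow> \<exists>s\<in>S. x - s \<in> A ` \<Gamma>"
    using discrete_subgroup_finite_index[OF \<Gamma>'(2,1) zmod_subspace_linear_image[OF lin \<Gamma>(1)]] sub by (metis image_subsetI)
  have "kernel (torus \<Gamma>) (torus \<Gamma>') \<phi> \<subseteq> (\<lambda>s. torus_proj \<Gamma> (inv_into UNIV A s)) ` S"
  proof
    fix X assume "X \<in> kernel (torus \<Gamma>) (torus \<Gamma>') \<phi>"
    then obtain x where x: "X = torus_proj \<Gamma> x" "A x \<in> \<Gamma>'"
      by (auto simp: kernel_def carrier_torus torus_one \<phi>(2) torus_proj_eq_iff[OF \<Gamma>'(1)])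
    then obtain s g where s: "s \<in> S" "g \<in> \<Gamma>" "A x - s = A g"
      using S(2) by (metis imageE)
    then have "s = A (x - g)"
      by (simp add: linear_diff[OF lin] algebra_simps)
    then have "inv_into UNIV A s = x - g"
      using A(2) by simp
    then have "X = torus_proj \<Gamma> (inv_into UNIV A s)"
      using s(2) by (simp add: x(1) torus_proj_eq_iff[OF \<Gamma>(1)])
    then show "X \<in> (\<lambda>s. torus_proj \<Gamma> (inv_into UNIV A s)) ` S"
      using s(1) by blast
  qed
  then have "finite (kernel (torus \<Gamma>) (torus \<Gamma>') \<phi>)"
    using S(1) finite_surj by blast
  moreover have "\<phi> ` carrier (torus \<Gamma>) = carrier (torus \<Gamma>')"
    using surj by (auto simp: carrier_torus \<phi>(2) image_iff) (metis surjD)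
  ultimately show ?thesis
    using \<phi>(1) by (auto simp: isogeny_def)
qed

section \<open>Complex multiplication\<close>

lemma zmod_subspace_lattice_power:
  assumes "zmod.subspace \<Lambda>"
  shows "zmod.subspace (lattice_power \<Lambda>)"
proof -
  have "vec (0::complex) = (0 :: complex^1)" "vec (a + b) = (vec a + vec b :: complex^1)"
    "vec (t *\<^sub>R a) = (t *\<^sub>R vec a :: complex^1)" for a b :: complex and t
    by (simp_all add: vec_eq_iff)
  then show ?thesis
    using assms by (auto simp: zmod.subspace_def lattice_power_def)
qed

lemma discrete_lattice_power:
  assumes "discrete \<Lambda>" and "zmod.subspace \<Lambda>"
  shows "discrete (lattice_power \<Lambda> :: (complex^'n) set)"
proof -
  obtain e where e: "e > 0" "\<And>x y. x \<in> \<Lambda> \<Longrightarrow> y \<in> \<Lambda> \<Longrightarrow> dist x y < e \<Longrightarrow> x = y"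
    using uniform_discrete_subgroup[OF assms] unfolding uniform_discrete_def by metis
  have "uniform_discrete (lattice_power \<Lambda> :: (complex^'n) set)"
  proof (rule uniformI1[OF e(1)])
    fix x y :: "complex^'n"
    assume xy: "x \<in> lattice_power \<Lambda>" "y \<in> lattice_power \<Lambda>" "dist x y < e"
    have "x $ i = y $ i" for i
    proof -
      have "dist (vec (x $ i) :: complex^1) (vec (y $ i)) = dist (x $ i) (y $ i)"
        by (simp add: dist_norm norm_vector_1)
      also have "\<dots> < e"
        using dist_vec_nth_le[of x i y] xy(3) by simp
      finally have "(vec (x $ i) :: complex^1) = vec (y $ i)"
        using xy(1,2) by (intro e(2)) (simp_all add: lattice_power_def)
      then show ?thesis
        by (simp add: vec_eq_iff)
    qed
    then show "x = y"
      by (simp add: vec_eq_iff)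
  qed
  then show ?thesis
    by (rule uniform_discrete_imp_discrete)
qed

lemma span_lattice_power:
  assumes "zmod.subspace \<Lambda>" and "span \<Lambda> = UNIV"
  shows "span (lattice_power \<Lambda> :: (complex^'n) set) = UNIV"
proof -
  have ax: "axis i c \<in> span (lattice_power \<Lambda> :: (complex^'n) set)" for i :: 'n and c
  proof -
    define f where "f z = (axis i (z $ 1) :: complex^'n)" for z :: "complex^1"
    have lin: "linear f"
      by (rule linearI) (simp_all add: f_def vec_eq_iff axis_def)
    have "f ` \<Lambda> \<subseteq> lattice_power \<Lambda>"
    proof (clarsimp simp: lattice_power_def f_def)
      fix z :: "complex^1" and j assume "z \<in> \<Lambda>"
      moreover have "vec (axis i (z $ 1) $ j) = (if j = i then z else 0)"
        by (simp add: vec_eq_iff axis_def)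
      ultimately show "vec (axis i (z $ 1) $ j) \<in> \<Lambda>"
        using zmod.subspace_0[OF assms(1)] by simp
    qed
    then have "span (f ` \<Lambda>) \<subseteq> span (lattice_power \<Lambda>)"
      by (rule span_mono)
    moreover have "axis i c = f (vec c)"
      by (simp add: f_def)
    ultimately show ?thesis
      using assms(2) by (auto simp: span_linear_image[OF lin])
  qed
  have "x \<in> span (lattice_power \<Lambda>)" for x :: "complex^'n"
  proof -
    have "x = (\<Sum>i\<in>UNIV. axis i (x $ i))"
      by (simp add: vec_eq_iff axis_def)
    then show ?thesis
      using ax span_sum by metis
  qed
  then show ?thesis
    by blast
qed

lemma lattice_power_stable:
  assumes "\<And>z. z \<in> \<Lambda> \<Longrightarrow> \<alpha> *s z \<in> \<Lambda>" and "x \<in> lattice_power \<Lambda>"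
  shows "\<alpha> *s x \<in> lattice_power \<Lambda>"
proof -
  have "vec (\<alpha> * a) = (\<alpha> *s vec a :: complex^1)" for a
    by (simp add: vec_eq_iff)
  then show ?thesis
    using assms by (auto simp: lattice_power_def)
qed

lemma End_lifts_eq:
  assumes "zmod.subspace \<Lambda>"
  shows "End_lifts \<Lambda> = {c. \<forall>z\<in>\<Lambda>. c *s z \<in> \<Lambda>}"
proof (intro equalityI subsetI CollectI ballI)
  fix c z assume "c \<in> End_lifts \<Lambda>" "z \<in> \<Lambda>"
  then obtain \<phi> where \<phi>: "\<And>w. \<phi> (torus_proj \<Lambda> w) = torus_proj \<Lambda> (c *s w)"
    by (auto simp: End_lifts_def)
  have "torus_proj \<Lambda> z = torus_proj \<Lambda> 0"
    using \<open>z \<in> \<Lambda>\<close> by (simp add: torus_proj_eq_iff[OF assms])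
  then have "torus_proj \<Lambda> (c *s z) = torus_proj \<Lambda> (c *s 0)"
    using \<phi> by metis
  then show "c *s z \<in> \<Lambda>"
    by (simp add: torus_proj_eq_iff[OF assms])
next
  fix c assume c: "c \<in> {c. \<forall>z\<in>\<Lambda>. c *s z \<in> \<Lambda>}"
  have "Vector_Spaces.linear (*s) (*s) (\<lambda>z::complex^1. c *s z)"
    by (simp add: vec.linear_scale_self)
  then obtain \<phi> where "\<phi> \<in> holomorphic_hom \<Lambda> \<Lambda>" "\<And>z. \<phi> (torus_proj \<Lambda> z) = torus_proj \<Lambda> (c *s z)"
    using linear_induces_holomorphic_hom[OF _ assms assms, of "\<lambda>z. c *s z"] c by blast
  then show "c \<in> End_lifts \<Lambda>"
    by (auto simp: End_lifts_def)
qed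

lemma complex_multiplication_iff:
  assumes "complex_lattice \<Lambda>"
  shows "complex_multiplication \<Lambda> \<longleftrightarrow> (\<exists>\<alpha>. Im \<alpha> \<noteq> 0 \<and> (\<forall>z\<in>\<Lambda>. \<alpha> *s z \<in> \<Lambda>))"
proof -
  note sub = complex_lattice_subgroup[OF assms]
  have EndQ: "EndQ \<Lambda> = {of_rat r * c |r c. \<forall>z\<in>\<Lambda>. c *s z \<in> \<Lambda>}"
    by (simp add: EndQ_def End_lifts_eq[OF sub])
  have Rats: "\<rat> \<subseteq> EndQ \<Lambda>"
  proof
    fix x :: complex assume "x \<in> \<rat>"
    then obtain r where "x = of_rat r"
      by (auto elim: Rats_cases)
    then show "x \<in> EndQ \<Lambda>"
      unfolding EndQ by (intro CollectI exI[of _ r] exI[of _ 1]) simp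
  qed
  have real: "c \<in> \<rat>" if c: "\<forall>z\<in>\<Lambda>. c *s z \<in> \<Lambda>" and "Im c = 0" for c
  proof -
    obtain B where B: "finite B" "independent B" "span B = UNIV" "zmod.span B = \<Lambda>"
      using complex_lattice_basis[OF assms] .
    have "B \<noteq> {}"
    proof
      assume "B = {}"
      then have "(1::complex^1) = 0"
        using B(3) by (metis UNIV_I singletonD span_empty)
      then show False
        by simp
    qed
    then obtain b where b: "b \<in> B"
      by blast
    have "c *s b \<in> zmod.span B"
      using c b B(4) zmod.span_base by blast
    moreover have "c *s b = Re c *\<^sub>R b"
      using \<open>Im c = 0\<close> by (simp add: vec_eq_iff complex_eq_iff)
    ultimately have "Re c *\<^sub>R b \<in> range (\<lambda>u. \<Sum>v\<in>B. of_int (u v) *\<^sub>R v)"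
      by (simp add: zmod.span_finite[OF B(1)])
    then obtain u :: "complex^1 \<Rightarrow> int" where u: "Re c *\<^sub>R b = (\<Sum>v\<in>B. of_int (u v) *\<^sub>R v)"
      by blast
    have "Re c *\<^sub>R b = (\<Sum>v\<in>B. (if v = b then Re c else 0) *\<^sub>R v)"
      using B(1) b by (simp add: if_distrib[of "\<lambda>t. t *\<^sub>R _"] cong: if_cong)
    then have "(\<Sum>v\<in>B. (of_int (u v) - (if v = b then Re c else 0)) *\<^sub>R v) = 0"
      using u by (simp add: scaleR_left_diff_distrib sum_subtractf)
    then have "of_int (u b) - (if b = b then Re c else 0) = 0"
      using independentD[OF B(2,1) subset_refl _ b, of "\<lambda>v. of_int (u v) - (if v = b then Re c else 0)"]
      by simp
    then have "c = of_int (u b)"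
      using \<open>Im c = 0\<close> by (simp add: complex_eq_iff)
    then show ?thesis
      by simp
  qed
  show ?thesis
  proof
    assume "complex_multiplication \<Lambda>"
    then obtain r c where "of_rat r * c \<notin> \<rat>" "\<forall>z\<in>\<Lambda>. c *s z \<in> \<Lambda>"
      using Rats unfolding complex_multiplication_def EndQ by blast
    moreover from this have "c \<notin> \<rat>"
      by (metis Rats_mult Rats_of_rat)
    ultimately show "\<exists>\<alpha>. Im \<alpha> \<noteq> 0 \<and> (\<forall>z\<in>\<Lambda>. \<alpha> *s z \<in> \<Lambda>)"
      using real by blast
  next
    assume "\<exists>\<alpha>. Im \<alpha> \<noteq> 0 \<and> (\<forall>z\<in>\<Lambda>. \<alpha> *s z \<in> \<Lambda>)"
    then obtain \<alpha> where \<alpha>: "Im \<alpha> \<noteq> 0" "\<forall>z\<in>\<Lambda>. \<alpha> *s z \<in> \<Lambda>"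
      by blast
    have "\<alpha> \<in> EndQ \<Lambda>"
      unfolding EndQ using \<alpha>(2) by (intro CollectI exI[of _ 1] exI[of _ \<alpha>]) simp
    moreover have "\<alpha> \<notin> \<rat>"
    proof
      assume "\<alpha> \<in> \<rat>"
      then obtain a b :: int where "\<alpha> = of_int a / of_int b"
        by (auto elim: Rats_cases')
      then have "\<alpha> \<in> \<real>"
        by simp
      then show False
        using \<alpha>(1) by (simp add: complex_is_Real_iff)
    qed
    ultimately show "complex_multiplication \<Lambda>"
      by (auto simp: complex_multiplication_def)
  qed
qed

lemma stable_transfer:
  fixes A :: "complex^'n \<Rightarrow> complex^'n"
  assumes A: "Vector_Spaces.linear (*s) (*s) A" "inj A"
    and \<Gamma>: "zmod.subspace \<Gamma>" "span \<Gamma> = UNIV" and \<Gamma>': "zmod.subspace \<Gamma>'" "discrete \<Gamma>'"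
    and sub: "\<And>g. g \<in> \<Gamma> \<Longrightarrow> A g \<in> \<Gamma>'" and \<alpha>: "Im \<alpha> \<noteq> 0"
  shows stable_transfer_forward:
      "(\<And>g. g \<in> \<Gamma> \<Longrightarrow> \<alpha> *s g \<in> \<Gamma>) \<Longrightarrow> \<exists>\<beta>. Im \<beta> \<noteq> 0 \<and> (\<forall>x\<in>\<Gamma>'. \<beta> *s x \<in> \<Gamma>')"
    and stable_transfer_backward:
      "(\<And>x. x \<in> \<Gamma>' \<Longrightarrow> \<alpha> *s x \<in> \<Gamma>') \<Longrightarrow> \<exists>\<beta>. Im \<beta> \<noteq> 0 \<and> (\<forall>g\<in>\<Gamma>. \<beta> *s g \<in> \<Gamma>)"
proof -
  interpret A: Vector_Spaces.linear "(*s)" "(*s)" A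
    by (fact A(1))
  note lin = clinear_imp_linear[OF A(1)]
  have surj: "surj A"
    using lin A(2) by (rule linear_injective_imp_surjective) simp
  have "\<Gamma>' \<subseteq> span (A ` \<Gamma>)"
    by (simp add: span_linear_image[OF lin] \<Gamma>(2) surj)
  then obtain N :: int where N: "N > 0" "\<And>x. x \<in> \<Gamma>' \<Longrightarrow> of_int N *\<^sub>R x \<in> A ` \<Gamma>"
    using discrete_subgroup_finite_exponent[OF \<Gamma>'(2,1) zmod_subspace_linear_image[OF lin \<Gamma>(1)]] sub
    by (metis image_subsetI)
  have NR: "(of_int N * \<alpha>) *s x = of_int N *\<^sub>R (\<alpha> *s x)" "(of_int N * \<alpha>) *s x = \<alpha> *s (of_int N *\<^sub>R x)"
    for x :: "complex^'n"
    by (simp_all add: scaleR_eq_of_real_scale mult.commute)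
  have Im: "Im (of_int N * \<alpha>) \<noteq> 0"
    using \<alpha> N(1) by simp
  show "\<exists>\<beta>. Im \<beta> \<noteq> 0 \<and> (\<forall>x\<in>\<Gamma>'. \<beta> *s x \<in> \<Gamma>')" if st: "\<And>g. g \<in> \<Gamma> \<Longrightarrow> \<alpha> *s g \<in> \<Gamma>"
  proof (intro exI conjI ballI)
    fix x assume "x \<in> \<Gamma>'"
    then obtain g where "g \<in> \<Gamma>" "of_int N *\<^sub>R x = A g"
      using N(2) by blast
    then show "(of_int N * \<alpha>) *s x \<in> \<Gamma>'"
      using st sub by (simp add: NR(2) A.scale[symmetric])
  qed (rule Im)
  show "\<exists>\<beta>. Im \<beta> \<noteq> 0 \<and> (\<forall>g\<in>\<Gamma>. \<beta> *s g \<in> \<Gamma>)" if st: "\<And>x. x \<in> \<Gamma>' \<Longrightarrow> \<alpha> *s x \<in> \<Gamma>'"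
  proof (intro exI conjI ballI)
    fix g assume "g \<in> \<Gamma>"
    then have "of_int N *\<^sub>R (\<alpha> *s A g) \<in> A ` \<Gamma>"
      using N(2) st sub by blast
    then have "A ((of_int N * \<alpha>) *s g) \<in> A ` \<Gamma>"
      by (simp only: A.scale linear_scale[OF lin] NR(1))
    then show "(of_int N * \<alpha>) *s g \<in> \<Gamma>"
      using A(2) by (simp add: inj_image_mem_iff)
  qed (rule Im)
qed

proposition isogenous_CM_power_imp_closure_complex:
  fixes \<Gamma> :: "(complex^'n) set" and \<Lambda> :: "(complex^1) set"
  assumes \<Gamma>: "complex_lattice \<Gamma>" and \<Lambda>: "complex_lattice \<Lambda>" "complex_multiplication \<Lambda>"
    and iso: "isogenous \<Gamma> (lattice_power \<Lambda>)" and H: "connected_complex_Lie_subgroup \<Gamma> H"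
  shows "complex_subtorus \<Gamma> (torus_topology \<Gamma> closure_of H)"
proof -
  note \<Gamma>_props = complex_lattice_subgroup[OF \<Gamma>] complex_lattice_discrete[OF \<Gamma>] complex_lattice_span[OF \<Gamma>]
  note \<Lambda>_props = complex_lattice_subgroup[OF \<Lambda>(1)] complex_lattice_discrete[OF \<Lambda>(1)] complex_lattice_span[OF \<Lambda>(1)]
  define \<Gamma>' where "\<Gamma>' = (lattice_power \<Lambda> :: (complex^'n) set)"
  have \<Gamma>': "zmod.subspace \<Gamma>'" "discrete \<Gamma>'" "span \<Gamma>' = UNIV"
    unfolding \<Gamma>'_def
    by (intro zmod_subspace_lattice_power discrete_lattice_power span_lattice_power \<Lambda>_props)+
  obtain \<alpha> where "Im \<alpha> \<noteq> 0" "\<And>z. z \<in> \<Lambda> \<Longrightarrow> \<alpha> *s z \<in> \<Lambda>"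
    using \<Lambda> complex_multiplication_iff by blast
  then have \<alpha>: "Im \<alpha> \<noteq> 0" "\<And>x. x \<in> \<Gamma>' \<Longrightarrow> \<alpha> *s x \<in> \<Gamma>'"
    unfolding \<Gamma>'_def using lattice_power_stable by blast+
  consider \<phi> where "isogeny \<Gamma> \<Gamma>' \<phi>" | \<phi> where "isogeny \<Gamma>' \<Gamma> \<phi>"
    using iso unfolding isogenous_def \<Gamma>'_def by blast
  then obtain \<beta> where \<beta>: "Im \<beta> \<noteq> 0" "\<And>g. g \<in> \<Gamma> \<Longrightarrow> \<beta> *s g \<in> \<Gamma>"
  proof cases
    case 1
    obtain A where A: "Vector_Spaces.linear (*s) (*s) A" "inj A" "\<And>g. g \<in> \<Gamma> \<Longrightarrow> A g \<in> \<Gamma>'"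
      using isogeny_lift[OF 1 \<Gamma>_props(1,2) \<Gamma>'(1,2)] by blast
    show ?thesis
      using stable_transfer_backward[OF A(1,2) \<Gamma>_props(1,3) \<Gamma>'(1,2) A(3) \<alpha>(1)] \<alpha>(2) that by blast
  next
    case 2
    obtain A where A: "Vector_Spaces.linear (*s) (*s) A" "inj A" "\<And>g. g \<in> \<Gamma>' \<Longrightarrow> A g \<in> \<Gamma>"
      using isogeny_lift[OF 2 \<Gamma>'(1,2) \<Gamma>_props(1,2)] by blast
    show ?thesis
      using stable_transfer_forward[OF A(1,2) \<Gamma>'(1,3) \<Gamma>_props(1,2) A(3) \<alpha>(1)] \<alpha>(2) that by blast
  qed
  obtain V where V: "vec.subspace V" "H = torus_proj \<Gamma> ` V"
    using H by (auto simp: connected_complex_Lie_subgroup_def)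
  have "zmod.subspace V"
    by (intro subspace_imp_zmod_subspace vec_subspace_imp_subspace V)
  then show ?thesis
    unfolding V(2) using complex_subtorus_closure_of_iff[OF \<Gamma>_props(1)]
      closure_saturation_of_stable[OF \<Gamma>_props(1) V(1) \<beta>] by blast
qed

section \<open>Functionals with integral real part\<close>

definition dual_lattice :: "'a::euclidean_space set \<Rightarrow> 'a set" where
  "dual_lattice \<Gamma> = {a. \<forall>g\<in>\<Gamma>. g \<bullet> a \<in> \<int>}"

lemma span_dual_lattice:
  fixes B :: "'a::euclidean_space set"
  assumes ind: "independent B" and span: "span B = UNIV"
  shows "span (dual_lattice (zmod.span B)) = UNIV"
proof (rule ccontr)
  assume "span (dual_lattice (zmod.span B)) \<noteq> UNIV"
  then obtain c where c: "c \<noteq> 0" "\<forall>a\<in>span (dual_lattice (zmod.span B)). c \<bullet> a = 0"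
    using span_not_UNIV_orthogonal by blast
  have fin: "finite B"
    using ind by (rule independent_imp_finite)
  obtain u where u: "c = (\<Sum>v\<in>B. u v *\<^sub>R v)"
    using span span_finite[OF fin] by (metis (no_types, lifting) UNIV_I imageE)
  have "u b = 0" if b: "b \<in> B" for b
  proof -
    have "b \<notin> span (B - {b})"
      using ind b by (auto simp: dependent_def)
    then have "span (B - {b}) \<noteq> UNIV"
      by blast
    then obtain a where a: "a \<noteq> 0" "\<forall>x\<in>span (B - {b}). a \<bullet> x = 0"
      using span_not_UNIV_orthogonal by blast
    have ab: "a \<bullet> b \<noteq> 0"
    proof
      assume "a \<bullet> b = 0"
      have "a \<bullet> x = 0" if "x \<in> span B" for x
        using that
      proof (rule span_induct)
        show "subspace {x. a \<bullet> x = 0}"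
          by (rule subspace_hyperplane)
        show "a \<bullet> x = 0" if "x \<in> B" for x
          using that a(2) span_base[of x "B - {b}"] \<open>a \<bullet> b = 0\<close> by (cases "x = b") auto
      qed
      then show False
        using span a(1) by (metis UNIV_I inner_eq_zero_iff)
    qed
    define d where "d = a /\<^sub>R (a \<bullet> b)"
    have d: "v \<bullet> d = (if v = b then 1 else 0)" if "v \<in> B" for v
      using that a(2) span_base[of v "B - {b}"] ab by (auto simp: d_def inner_commute)
    have "zmod.subspace {g. g \<bullet> d \<in> \<int>}"
      by (auto simp: zmod.subspace_def inner_add_left)
    then have "zmod.span B \<subseteq> {g. g \<bullet> d \<in> \<int>}"
      using d by (intro zmod.span_minimal) auto
    then have "c \<bullet> d = 0"
      by (intro bspec[OF c(2)] span_base) (auto simp: dual_lattice_def)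
    moreover have "c \<bullet> d = (\<Sum>v\<in>B. u v * (if v = b then 1 else 0))"
      unfolding u inner_sum_left using d by (intro sum.cong) auto
    ultimately show "u b = 0"
      using fin b by (simp add: if_distrib cong: if_cong)
  qed
  then show False
    using c(1) u by simp
qed

lemma kernel_subset_span_lattice:
  fixes f :: "'a::euclidean_space \<Rightarrow> 'b::euclidean_space"
  assumes f: "linear f" and \<Gamma>: "zmod.subspace \<Gamma>" "span \<Gamma> = UNIV" and disc: "discrete (f ` \<Gamma>)"
  shows "{x. f x = 0} \<subseteq> span {g \<in> \<Gamma>. f g = 0}"
proof
  fix x assume fx: "x \<in> {x. f x = 0}"
  obtain B where B: "B \<subseteq> f ` \<Gamma>" "independent B" "f ` \<Gamma> \<subseteq> span B"
    using maximal_independent_subset[of "f ` \<Gamma>"] by blast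
  have fin: "finite B"
    using B(2) by (rule independent_imp_finite)
  define s where "s b = (SOME g. g \<in> \<Gamma> \<and> f g = b)" for b
  have "s b \<in> \<Gamma> \<and> f (s b) = b" if "b \<in> B" for b
  proof -
    have "\<exists>g. g \<in> \<Gamma> \<and> f g = b"
      using B(1) that by auto
    then show ?thesis
      unfolding s_def by (rule someI_ex)
  qed
  then have s: "\<And>b. b \<in> B \<Longrightarrow> s b \<in> \<Gamma>" "\<And>b. b \<in> B \<Longrightarrow> f (s b) = b"
    by auto
  have fsB: "f ` s ` B = B"
    using s(2) by (auto simp: image_iff)
  have "zmod.span B \<subseteq> f ` \<Gamma>"
    using B(1) zmod_subspace_linear_image[OF f \<Gamma>(1)] by (rule zmod.span_minimal)
  moreover have "f ` \<Gamma> \<subseteq> span (zmod.span B)"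
    using B(3) span_mono[OF zmod.span_superset] by (rule order_trans)
  ultimately obtain N :: int where N: "N > 0" "\<And>y. y \<in> f ` \<Gamma> \<Longrightarrow> of_int N *\<^sub>R y \<in> zmod.span B"
    using discrete_subgroup_finite_exponent[OF disc zmod_subspace_linear_image[OF f \<Gamma>(1)] zmod.subspace_span]
    by blast
  have "\<Gamma> \<subseteq> span ({g \<in> \<Gamma>. f g = 0} \<union> s ` B)" (is "_ \<subseteq> ?S")
  proof
    fix g assume g: "g \<in> \<Gamma>"
    then have "of_int N *\<^sub>R f g \<in> range (\<lambda>m. \<Sum>b\<in>B. of_int (m b) *\<^sub>R b)"
      using N(2)[of "f g"] zmod.span_finite[OF fin] by auto
    then obtain m :: "'b \<Rightarrow> int" where m: "of_int N *\<^sub>R f g = (\<Sum>b\<in>B. of_int (m b) *\<^sub>R b)"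
      by blast
    define h where "h = (\<Sum>b\<in>B. of_int (m b) *\<^sub>R s b)"
    have "f h = (\<Sum>b\<in>B. of_int (m b) *\<^sub>R b)"
      using s(2) by (simp add: h_def linear_sum[OF f] linear_scale[OF f])
    then have "f (of_int N *\<^sub>R g - h) = 0"
      by (simp add: linear_diff[OF f] linear_scale[OF f] m)
    moreover have "h \<in> \<Gamma>"
      unfolding h_def using s(1) by (intro zmod.subspace_sum zmod.subspace_scale \<Gamma>(1))
    then have "of_int N *\<^sub>R g - h \<in> \<Gamma>"
      using g by (intro zmod.subspace_diff zmod.subspace_scale \<Gamma>(1))
    ultimately have "of_int N *\<^sub>R g - h \<in> ?S"
      by (intro span_base) simp
    moreover have "h \<in> ?S"
      unfolding h_def by (intro span_sum span_scale span_base) auto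
    ultimately have "of_int N *\<^sub>R g \<in> ?S"
      using span_add[of "of_int N *\<^sub>R g - h" _ h] by simp
    then have "(1 / of_int N) *\<^sub>R (of_int N *\<^sub>R g) \<in> ?S"
      by (rule span_scale)
    then show "g \<in> ?S"
      using N(1) by simp
  qed
  then have "x \<in> ?S"
    using \<Gamma>(2) by (metis UNIV_I span_mono span_span subsetD)
  then obtain w y where wy: "w \<in> span {g \<in> \<Gamma>. f g = 0}" "y \<in> span (s ` B)" "x = w + y"
    by (auto simp: span_Un)
  have "subspace {x. f x = 0}"
    using f by (rule linear_subspace_kernel)
  then have "f w = 0"
    using wy(1) span_minimal[of "{g \<in> \<Gamma>. f g = 0}" "{x. f x = 0}"] by auto
  then have "f y = f 0"
    using fx by (simp add: wy(3) linear_add[OF f] linear_0[OF f])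
  moreover have "inj_on f (span (s ` B))"
  proof -
    have "inj_on f (s ` B)"
      using s(2) by (auto simp: inj_on_def)
    then show ?thesis
      using linear_inj_on_span_iff_independent_image[OF f, of "s ` B"] fsB B(2) by simp
  qed
  ultimately have "y = 0"
    using wy(2) span_zero by (metis inj_onD)
  then show "x \<in> span {g \<in> \<Gamma>. f g = 0}"
    using wy by simp
qed

definition hprod :: "complex^'n \<Rightarrow> complex^'n \<Rightarrow> complex" where
  "hprod x a = (\<Sum>i\<in>UNIV. x $ i * cnj (a $ i))"

lemma hprod_add_left: "hprod (x + y) a = hprod x a + hprod y a"
  and hprod_add_right: "hprod x (a + b) = hprod x a + hprod x b"
  and hprod_diff_left: "hprod (x - y) a = hprod x a - hprod y a"
  and hprod_scale_left: "hprod (c *s x) a = c * hprod x a"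
  and hprod_scale_right: "hprod x (c *s a) = cnj c * hprod x a"
  by (simp_all add: hprod_def algebra_simps sum.distrib sum_subtractf sum_distrib_left)

lemma hprod_0 [simp]: "hprod 0 a = 0" "hprod x 0 = 0"
  by (simp_all add: hprod_def)

lemma inner_eq_Re_hprod: "x \<bullet> a = Re (hprod x a)"
  by (simp add: inner_vec_def hprod_def inner_complex_def)

lemma hprod_self_eq_0_iff [simp]: "hprod x x = 0 \<longleftrightarrow> x = 0"
  by (metis hprod_0(1) inner_eq_Re_hprod inner_eq_zero_iff zero_complex.simps(1))

lemma linear_hprod: "linear (\<lambda>x. hprod x a)"
  by (rule linearI) (simp_all add: hprod_add_left scaleR_eq_of_real_scale hprod_scale_left scaleR_conv_of_real)

text \<open>Hermitian product against \<open>a\<close> is the \<open>\<complex>\<close>-linear functional whose real part is \<open>x \<bullet> a\<close>,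
  so the dual lattice parametrises the functionals with integral real part on \<open>\<Gamma>\<close>.\<close>

locale complex_closure_lattice =
  fixes \<Gamma> :: "(complex^'n) set"
  assumes \<Gamma>: "complex_lattice \<Gamma>"
    and closure_complex: "\<And>V. vec.subspace V \<Longrightarrow>
      \<exists>W. vec.subspace W \<and> closure (saturation \<Gamma> V) = saturation \<Gamma> W"
begin

lemmas subgroup = complex_lattice_subgroup[OF \<Gamma>]
lemmas discrete_lattice = complex_lattice_discrete[OF \<Gamma>]
lemmas span_lattice = complex_lattice_span[OF \<Gamma>]

lemma subgroup_image: "zmod.subspace ((\<lambda>x. hprod x a) ` \<Gamma>)"
  by (rule zmod_subspace_linear_image[OF linear_hprod subgroup])

lemma span_dual: "span (dual_lattice \<Gamma>) = UNIV"
proof -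
  obtain B where "independent B" "span B = UNIV" "zmod.span B = \<Gamma>"
    using complex_lattice_basis[OF \<Gamma>] by blast
  then show ?thesis
    using span_dual_lattice[of B] by simp
qed

lemma discrete_image:
  assumes a: "a \<in> dual_lattice \<Gamma>" "a \<noteq> 0"
  shows "discrete ((\<lambda>x. hprod x a) ` \<Gamma>)"
proof (rule closed_countable_subgroup_discrete[OF _ subgroup_image])
  show "countable ((\<lambda>x. hprod x a) ` \<Gamma>)"
    by (intro countable_image discrete_subgroup_countable discrete_lattice subgroup)
  define V where "V = {x. hprod x a = 0}"
  have V: "vec.subspace V"
    by (auto simp: vec.subspace_def V_def hprod_add_left hprod_scale_left)
  obtain W where W: "vec.subspace W" "closure (saturation \<Gamma> V) = saturation \<Gamma> W"
    using closure_complex[OF V] by blast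
  have "saturation \<Gamma> V \<subseteq> {x. x \<bullet> a \<in> \<int>}"
  proof
    fix x assume "x \<in> saturation \<Gamma> V"
    then obtain v where "hprod v a = 0" "x - v \<in> \<Gamma>"
      by (auto simp: saturation_def V_def)
    moreover from this have "(x - v) \<bullet> a \<in> \<int>"
      using a(1) unfolding dual_lattice_def by blast
    ultimately show "x \<in> {x. x \<bullet> a \<in> \<int>}"
      by (simp add: inner_eq_Re_hprod hprod_diff_left)
  qed
  moreover have "closed {x. x \<bullet> a \<in> \<int>}"
  proof -
    have "closed ((\<lambda>x. x \<bullet> a) -` \<int>)"
      by (intro continuous_closed_vimage closed_Ints) (auto intro!: continuous_intros)
    then show ?thesis
      by (simp add: vimage_def)
  qed
  ultimately have W_int: "w \<bullet> a \<in> \<int>" if "w \<in> W" for w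
    using that closure_minimal W(2) subset_saturation[OF zmod.subspace_0[OF subgroup], of W] by blast
  have Re0: "Re (hprod w a) = 0" if w: "w \<in> W" for w
  proof (rule ccontr)
    assume "Re (hprod w a) \<noteq> 0"
    moreover have "(complex_of_real (1 / (2 * Re (hprod w a))) *s w) \<bullet> a \<in> \<int>"
      by (intro W_int vec.subspace_scale W w)
    ultimately have "(1/2 :: real) \<in> \<int>"
      by (simp add: inner_eq_Re_hprod hprod_scale_left)
    then show False
      using Ints_cases by fastforce
  qed
  \<comment> \<open>Only here is it used that \<open>W\<close> is complex: \<open>\<i> w \<in> W\<close> kills the imaginary part.\<close>
  have WV: "hprod w a = 0" if w: "w \<in> W" for w
    using Re0[OF w] Re0[OF vec.subspace_scale[OF W(1) w, of \<i>]]
    by (simp add: hprod_scale_left complex_eq_iff)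
  define u where "u = inverse (hprod a a) *s a"
  have u: "hprod (z *s u) a = z" for z
    using a(2) by (simp add: u_def hprod_scale_left)
  have "(\<lambda>z. z *s u) ` closure ((\<lambda>x. hprod x a) ` \<Gamma>) \<subseteq> closure (saturation \<Gamma> V)"
  proof (rule image_closure_subset)
    show "continuous_on (closure ((\<lambda>x. hprod x a) ` \<Gamma>)) (\<lambda>z. z *s u)"
      unfolding vector_scalar_mult_def by (intro continuous_intros)
    have "hprod g a *s u \<in> saturation \<Gamma> V" if "g \<in> \<Gamma>" for g
      unfolding saturation_def V_def using that
      by (intro CollectI bexI[of _ "hprod g a *s u - g"]) (simp_all add: hprod_diff_left u)
    then show "(\<lambda>z. z *s u) ` (\<lambda>x. hprod x a) ` \<Gamma> \<subseteq> closure (saturation \<Gamma> V)"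
      using closure_subset by blast
  qed simp
  then have *: "z *s u \<in> saturation \<Gamma> W" if "z \<in> closure ((\<lambda>x. hprod x a) ` \<Gamma>)" for z
    using that W(2) by blast
  have "closure ((\<lambda>x. hprod x a) ` \<Gamma>) \<subseteq> (\<lambda>x. hprod x a) ` \<Gamma>"
  proof
    fix z assume "z \<in> closure ((\<lambda>x. hprod x a) ` \<Gamma>)"
    from *[OF this] obtain w where w: "w \<in> W" "z *s u - w \<in> \<Gamma>"
      by (auto simp: saturation_def)
    have "z = hprod (z *s u - w) a"
      by (simp add: hprod_diff_left u WV[OF w(1)])
    then show "z \<in> (\<lambda>x. hprod x a) ` \<Gamma>"
      using w(2) by blast
  qed
  then show "closed ((\<lambda>x. hprod x a) ` \<Gamma>)"
    using closure_subset_eq by blast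
qed

lemma span_image_kernel:
  assumes b: "b \<in> dual_lattice \<Gamma>" "b \<noteq> 0" and a: "a \<notin> vec.span {b}"
  shows "span ((\<lambda>x. hprod x a) ` {g \<in> \<Gamma>. hprod g b = 0}) = UNIV"
proof -
  define x where "x = a - (hprod a b / hprod b b) *s b"
  have "x \<noteq> 0"
    using a by (auto simp: x_def vec.span_singleton)
  have xb: "hprod x b = 0"
    using b(2) by (simp add: x_def hprod_diff_left hprod_scale_left)
  have "a = x + (hprod a b / hprod b b) *s b"
    by (simp add: x_def)
  then have "hprod x a = hprod x x"
    using xb by (metis hprod_add_right hprod_scale_right mult_zero_right add.right_neutral)
  then have xa: "hprod x a \<noteq> 0"
    using \<open>x \<noteq> 0\<close> by simp
  have ker: "{x. hprod x b = 0} \<subseteq> span {g \<in> \<Gamma>. hprod g b = 0}"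
    by (rule kernel_subset_span_lattice[OF linear_hprod subgroup span_lattice discrete_image[OF b]])
  have "z \<in> (\<lambda>x. hprod x a) ` span {g \<in> \<Gamma>. hprod g b = 0}" for z
  proof
    show "z = hprod ((z / hprod x a) *s x) a"
      using xa by (simp add: hprod_scale_left)
    show "(z / hprod x a) *s x \<in> span {g \<in> \<Gamma>. hprod g b = 0}"
      using ker by (rule subsetD) (simp add: hprod_scale_left xb)
  qed
  then show ?thesis
    by (auto simp: span_linear_image[OF linear_hprod])
qed

lemma zmod_subspace_image_kernel:
  "zmod.subspace ((\<lambda>x. hprod x a) ` {g \<in> \<Gamma>. hprod g b = 0})"
proof -
  have "zmod.subspace {g. hprod g b = 0}"
    by (auto intro!: subspace_imp_zmod_subspace linear_subspace_kernel linear_hprod)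
  then have "zmod.subspace {g \<in> \<Gamma>. hprod g b = 0}"
    using zmod.subspace_inter[OF subgroup, of "{g. hprod g b = 0}"] by (simp add: Int_def)
  then show ?thesis
    by (rule zmod_subspace_linear_image[OF linear_hprod])
qed

lemma commensurable_independent:
  assumes a: "a \<in> dual_lattice \<Gamma>" "a \<noteq> 0" and b: "b \<in> dual_lattice \<Gamma>" "b \<noteq> 0"
    and ind: "b \<notin> vec.span {a}"
  shows "\<exists>N::int. N > 0 \<and> (\<forall>g\<in>\<Gamma>. of_int N * hprod g a \<in> (\<lambda>x. hprod x b) ` \<Gamma>)"
proof -
  have ind': "a \<notin> vec.span {b}"
  proof
    assume "a \<in> vec.span {b}"
    then obtain k where k: "a = k *s b"
      by (auto simp: vec.span_singleton)
    then have "b = inverse k *s a"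
      using a(2) by auto
    then show False
      using ind by (auto simp: vec.span_singleton)
  qed
  have ab: "a + b \<in> dual_lattice \<Gamma>"
    using a(1) b(1) by (auto simp: dual_lattice_def inner_add_right)
  have ab0: "a + b \<noteq> 0"
  proof
    assume "a + b = 0"
    then have "b = (-1) *s a"
      by (simp add: eq_neg_iff_add_eq_0 add.commute vec.scale_minus_left)
    then show False
      using ind unfolding vec.span_singleton by (metis rangeI)
  qed
  obtain N1 :: int where N1: "N1 > 0"
    "\<And>z. z \<in> (\<lambda>x. hprod x a) ` \<Gamma> \<Longrightarrow> of_int N1 *\<^sub>R z \<in> (\<lambda>x. hprod x a) ` {g \<in> \<Gamma>. hprod g b = 0}"
    using discrete_subgroup_finite_exponent[OF discrete_image[OF a] subgroup_image zmod_subspace_image_kernel, of a b]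
      span_image_kernel[OF b ind'] by blast
  \<comment> \<open>The functionals of \<open>a\<close> and of \<open>b\<close> are compared through that of \<open>a + b\<close>, which agrees with
    the first on \<open>ker b\<close> and with the second on \<open>ker a\<close>.\<close>
  have eq: "(\<lambda>x. hprod x b) ` {g \<in> \<Gamma>. hprod g a = 0} = (\<lambda>x. hprod x (a + b)) ` {g \<in> \<Gamma>. hprod g a = 0}"
    by (intro image_cong) (simp_all add: hprod_add_right)
  have "(\<lambda>x. hprod x b) ` {g \<in> \<Gamma>. hprod g a = 0} \<subseteq> (\<lambda>x. hprod x (a + b)) ` \<Gamma>"
    unfolding eq by blast
  then obtain N2 :: int where N2: "N2 > 0"
    "\<And>z. z \<in> (\<lambda>x. hprod x (a + b)) ` \<Gamma> \<Longrightarrow> of_int N2 *\<^sub>R z \<in> (\<lambda>x. hprod x b) ` {g \<in> \<Gamma>. hprod g a = 0}"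
    using discrete_subgroup_finite_exponent[OF discrete_image[OF ab ab0] subgroup_image zmod_subspace_image_kernel, of b a]
      span_image_kernel[OF a ind] by blast
  show ?thesis
  proof (intro exI[of _ "N2 * N1"] conjI ballI)
    fix g assume "g \<in> \<Gamma>"
    then obtain k where k: "k \<in> \<Gamma>" "hprod k b = 0" "of_int N1 *\<^sub>R hprod g a = hprod k a"
      using N1(2)[of "hprod g a"] by blast
    then have "of_int N1 *\<^sub>R hprod g a = hprod k (a + b)"
      by (simp add: hprod_add_right)
    then have "of_int N2 *\<^sub>R (of_int N1 *\<^sub>R hprod g a) \<in> (\<lambda>x. hprod x b) ` \<Gamma>"
      using N2(2)[of "hprod k (a + b)"] k(1) by auto
    then show "of_int (N2 * N1) * hprod g a \<in> (\<lambda>x. hprod x b) ` \<Gamma>"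
      by (simp add: scaleR_conv_of_real mult.assoc)
  qed (use N1 N2 in simp)
qed

lemma commensurable:
  assumes n: "CARD('n) \<ge> 2"
    and a: "a \<in> dual_lattice \<Gamma>" "a \<noteq> 0" and b: "b \<in> dual_lattice \<Gamma>" "b \<noteq> 0"
  shows "\<exists>N::int. N > 0 \<and> (\<forall>g\<in>\<Gamma>. of_int N * hprod g a \<in> (\<lambda>x. hprod x b) ` \<Gamma>)"
proof (cases "b \<in> vec.span {a}")
  case False
  then show ?thesis
    using commensurable_independent a b by blast
next
  case True
  have "\<exists>c\<in>dual_lattice \<Gamma>. c \<notin> vec.span {a}"
  proof (rule ccontr)
    assume "\<not> ?thesis"
    then have "dual_lattice \<Gamma> \<subseteq> vec.span {a}"
      by blast
    then have "span (dual_lattice \<Gamma>) \<subseteq> vec.span {a}"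
      by (intro span_minimal vec_subspace_imp_subspace vec.subspace_span)
    then have "(UNIV :: (complex^'n) set) \<subseteq> vec.span {a}"
      by (simp add: span_dual)
    then have "vec.dim (UNIV :: (complex^'n) set) \<le> card {a}"
      by (intro vec.dim_le_card) auto
    then show False
      using n by (simp add: card_cart_basis)
  qed
  then obtain c where c: "c \<in> dual_lattice \<Gamma>" "c \<notin> vec.span {a}"
    by blast
  have c0: "c \<noteq> 0"
    using c(2) vec.span_zero by blast
  have "b \<notin> vec.span {c}"
  proof
    assume "b \<in> vec.span {c}"
    then obtain k where "b = k *s c"
      by (auto simp: vec.span_singleton)
    then have "c = inverse k *s b"
      using b(2) by auto
    then show False
      using c(2) True vec.span_scale by blast
  qed
  then obtain N2 :: int where N2: "N2 > 0" "\<And>g. g \<in> \<Gamma> \<Longrightarrow> of_int N2 * hprod g c \<in> (\<lambda>x. hprod x b) ` \<Gamma>"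
    using commensurable_independent[OF c(1) c0 b] by blast
  obtain N1 :: int where N1: "N1 > 0" "\<And>g. g \<in> \<Gamma> \<Longrightarrow> of_int N1 * hprod g a \<in> (\<lambda>x. hprod x c) ` \<Gamma>"
    using commensurable_independent[OF a c(1) c0 c(2)] by blast
  show ?thesis
  proof (intro exI[of _ "N2 * N1"] conjI ballI)
    fix g assume "g \<in> \<Gamma>"
    then obtain k where "k \<in> \<Gamma>" "of_int N1 * hprod g a = hprod k c"
      using N1(2) by blast
    then show "of_int (N2 * N1) * hprod g a \<in> (\<lambda>x. hprod x b) ` \<Gamma>"
      using N2(2)[of k] by (simp add: mult.assoc)
  qed (use N1 N2 in simp)
qed

end

lemma independent_imp_zmod_independent:
  fixes B :: "'a::real_vector set"
  assumes "independent B"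
  shows "zmod.independent B"
  unfolding zmod.independent_explicit_module
proof (intro allI impI)
  fix s and u :: "'a \<Rightarrow> int" and v
  assume "finite s" "s \<subseteq> B" "(\<Sum>v\<in>s. of_int (u v) *\<^sub>R v) = 0" "v \<in> s"
  then have "of_int (u v) = (0::real)"
    by (rule independentD[OF assms])
  then show "u v = 0"
    by simp
qed

lemma zmod_span_linear_image:
  assumes "linear f"
  shows "zmod.span (f ` B) = f ` zmod.span B"
proof
  show "zmod.span (f ` B) \<subseteq> f ` zmod.span B"
    by (intro zmod.span_minimal image_mono zmod.span_superset zmod_subspace_linear_image assms
        zmod.subspace_span)
  have "zmod.subspace (f -` zmod.span (f ` B))"
    by (auto simp: zmod.subspace_def linear_0[OF assms] linear_add[OF assms] linear_scale[OF assms]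
        intro: zmod.span_zero zmod.span_add zmod.span_scale)
  then have "zmod.span B \<subseteq> f -` zmod.span (f ` B)"
    by (intro zmod.span_minimal) (auto intro: zmod.span_base)
  then show "f ` zmod.span B \<subseteq> zmod.span (f ` B)"
    by blast
qed

lemma complex_lattice_vec_span:
  fixes B :: "complex set"
  assumes B: "independent B" "span B = UNIV" and disc: "discrete (zmod.span B)"
  shows "complex_lattice (vec ` zmod.span B :: (complex^1) set)"
proof -
  have lin: "linear (vec :: complex \<Rightarrow> complex^1)"
    by (rule linearI) (simp_all add: vec_eq_iff)
  have inj: "inj (vec :: complex \<Rightarrow> complex^1)"
    by (simp add: inj_def vec_eq_iff)
  have "independent (vec ` B :: (complex^1) set)"
    using linear_independent_injective_image[OF lin B(1)] inj by (simp add: inj_on_subset)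
  then have "zmod.independent (vec ` B :: (complex^1) set)"
    by (rule independent_imp_zmod_independent)
  moreover have "card (vec ` B :: (complex^1) set) = 2 * CARD(1)"
  proof -
    have "card B = 2"
      using dim_eq_card[of B "UNIV :: complex set"] B by simp
    moreover have "card (vec ` B :: (complex^1) set) = card B"
      using inj by (intro card_image) (rule inj_on_subset, auto)
    ultimately show ?thesis
      by simp
  qed
  moreover obtain e where e: "e > 0" "\<And>x y. x \<in> zmod.span B \<Longrightarrow> y \<in> zmod.span B \<Longrightarrow> dist x y < e \<Longrightarrow> x = y"
    using uniform_discrete_subgroup[OF disc zmod.subspace_span] unfolding uniform_discrete_def by metis
  have "uniform_discrete (vec ` zmod.span B :: (complex^1) set)"
    by (rule uniformI1[OF e(1)]) (auto simp: dist_norm norm_vector_1 intro!: e(2))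
  ultimately show ?thesis
    unfolding complex_lattice_def zmod_span_linear_image[OF lin, symmetric]
    by (blast intro: uniform_discrete_imp_discrete)
qed

context complex_closure_lattice begin

lemma isogenous_CM_power:
  assumes n: "CARD('n) \<ge> 2"
  shows "\<exists>\<Lambda> :: (complex^1) set. complex_lattice \<Lambda> \<and> complex_multiplication \<Lambda> \<and>
    isogenous \<Gamma> (lattice_power \<Lambda>)"
proof -
  obtain a0 where a0: "a0 \<in> dual_lattice \<Gamma>" "a0 \<noteq> 0"
  proof (rule ccontr)
    assume "\<not> thesis"
    then have "dual_lattice \<Gamma> \<subseteq> {0}"
      using that by blast
    then have "span (dual_lattice \<Gamma>) \<subseteq> {0}"
      by (rule span_minimal) simp
    then have "(1 :: complex^'n) = 0"
      unfolding span_dual by blast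
    then show False
      by simp
  qed
  define f where "f x = hprod x a0" for x
  have lin: "linear f"
    unfolding f_def by (rule linear_hprod)
  have "range f = UNIV"
  proof -
    have "z = f ((z / hprod a0 a0) *s a0)" for z
      using a0(2) by (simp add: f_def hprod_scale_left)
    then show ?thesis
      by (metis UNIV_eq_I rangeI)
  qed
  then have spanL: "span (f ` \<Gamma>) = UNIV"
    by (simp add: span_linear_image[OF lin] span_lattice)
  have discL: "discrete (f ` \<Gamma>)"
    unfolding f_def by (rule discrete_image[OF a0])
  have subL: "zmod.subspace (f ` \<Gamma>)"
    unfolding f_def by (rule subgroup_image)
  obtain B where B: "B \<subseteq> f ` \<Gamma>" "independent B" "f ` \<Gamma> \<subseteq> span B"
    using maximal_independent_subset[of "f ` \<Gamma>"] by blast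
  define Z where "Z = zmod.span B"
  have spanB: "span B = UNIV"
    using B(3) spanL by (metis span_mono span_span top.extremum_uniqueI)
  have ZL: "Z \<subseteq> f ` \<Gamma>"
    unfolding Z_def using B(1) subL by (rule zmod.span_minimal)
  have Z: "zmod.subspace Z" "discrete Z"
    using discL ZL by (auto simp: Z_def)
  have "f ` \<Gamma> \<subseteq> span Z"
    using spanB span_mono[OF zmod.span_superset[of B]] by (auto simp: Z_def)
  then obtain M :: int where M: "M > 0" "\<And>z. z \<in> f ` \<Gamma> \<Longrightarrow> of_int M *\<^sub>R z \<in> Z"
    using discrete_subgroup_finite_exponent[OF discL subL Z(1) ZL] by blast
  have into_Z: "\<exists>N::int. N > 0 \<and> (\<forall>g\<in>\<Gamma>. of_int N * hprod g a \<in> Z)"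
    if a: "a \<in> dual_lattice \<Gamma>" "a \<noteq> 0" for a
  proof -
    obtain N :: int where N: "N > 0" "\<And>g. g \<in> \<Gamma> \<Longrightarrow> of_int N * hprod g a \<in> f ` \<Gamma>"
      using commensurable[OF n a a0] unfolding f_def by blast
    show ?thesis
      using N M(1) M(2)[OF N(2)]
      by (intro exI[of _ "M * N"]) (simp add: scaleR_conv_of_real mult.assoc)
  qed
  define \<Lambda> where "\<Lambda> = (vec ` Z :: (complex^1) set)"
  have \<Lambda>: "complex_lattice \<Lambda>"
    unfolding \<Lambda>_def Z_def using complex_lattice_vec_span[OF B(2) spanB] Z(2) by (simp add: Z_def)
  have vec_\<Lambda>: "vec z \<in> \<Lambda> \<longleftrightarrow> z \<in> Z" for z
    by (auto simp: \<Lambda>_def vec_eq_iff)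

  \<comment> \<open>A nonreal point \<open>d\<close> of the dual of \<open>Z\<close> gives a second functional \<open>a1\<close>, a complex multiple
    of \<open>a0\<close>; commensurability of their images makes the factor a complex multiplication.\<close>
  obtain d where d: "Im d \<noteq> 0" "\<And>z. z \<in> Z \<Longrightarrow> z \<bullet> d \<in> \<int>"
  proof (rule ccontr)
    assume "\<not> thesis"
    then have "dual_lattice Z \<subseteq> {c. Im c = 0}"
      using that unfolding dual_lattice_def by blast
    moreover have "subspace {c. Im c = 0}"
      by (simp add: subspace_def)
    ultimately have "span (dual_lattice Z) \<subseteq> {c. Im c = 0}"
      by (rule span_minimal)
    then have "\<i> \<in> {c. Im c = 0}"
      unfolding Z_def span_dual_lattice[OF B(2) spanB] by blast
    then show False
      by simp
  qed
  define a1 where "a1 = (of_int M * d) *s a0"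
  have "a1 \<in> dual_lattice \<Gamma>"
    unfolding dual_lattice_def
  proof (intro CollectI ballI)
    fix g assume "g \<in> \<Gamma>"
    then have "(of_int M *\<^sub>R f g) \<bullet> d \<in> \<int>"
      using M(2) d(2) by blast
    moreover have "(of_int M *\<^sub>R f g) \<bullet> d = g \<bullet> a1"
      by (simp add: inner_eq_Re_hprod a1_def hprod_scale_right f_def inner_complex_def algebra_simps)
    ultimately show "g \<bullet> a1 \<in> \<int>"
      by simp
  qed
  moreover have "a1 \<noteq> 0"
    using M(1) d(1) a0(2) by (auto simp: a1_def)
  ultimately obtain N :: int where N: "N > 0" "\<And>g. g \<in> \<Gamma> \<Longrightarrow> of_int N * hprod g a1 \<in> Z"
    using into_Z by blast
  define \<alpha> where "\<alpha> = of_int N * (of_int M * cnj d)"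
  have "\<alpha> * z \<in> Z" if z: "z \<in> Z" for z
  proof -
    obtain g where "g \<in> \<Gamma>" "z = hprod g a0"
      using z ZL by (auto simp: f_def)
    then show ?thesis
      using N(2)[of g] by (simp add: a1_def hprod_scale_right \<alpha>_def mult.assoc)
  qed
  moreover have "\<alpha> *s (vec z :: complex^1) = vec (\<alpha> * z)" for z
    by (simp add: vec_eq_iff)
  ultimately have "\<forall>z\<in>\<Lambda>. \<alpha> *s z \<in> \<Lambda>"
    by (auto simp: \<Lambda>_def)
  moreover have "Im \<alpha> \<noteq> 0"
    using N(1) M(1) d(1) by (simp add: \<alpha>_def)
  ultimately have CM: "complex_multiplication \<Lambda>"
    unfolding complex_multiplication_iff[OF \<Lambda>] by blast

  obtain C where C: "C \<subseteq> dual_lattice \<Gamma>" "vec.independent C" "dual_lattice \<Gamma> \<subseteq> vec.span C"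
    using vec.maximal_independent_subset[of "dual_lattice \<Gamma>"] by blast
  have spanC: "vec.span C = UNIV"
  proof -
    have "span (dual_lattice \<Gamma>) \<subseteq> vec.span C"
      using C(3) by (intro span_minimal vec_subspace_imp_subspace vec.subspace_span)
    then show ?thesis
      by (simp add: span_dual top.extremum_uniqueI)
  qed
  have "card C = CARD('n)"
    using vec.dim_eq_card[of C UNIV] C(2) spanC by (simp add: card_cart_basis)
  then obtain a where a: "bij_betw a (UNIV :: 'n set) C"
    using finite_same_card_bij[of "UNIV :: 'n set" C] vec.finiteI_independent[OF C(2)] by auto
  have aC: "a i \<in> C" for i
    using a by (auto simp: bij_betw_def)
  have "\<exists>N::int. N > 0 \<and> (\<forall>g\<in>\<Gamma>. of_int N * hprod g (a i) \<in> Z)" for i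
  proof (rule into_Z)
    show "a i \<in> dual_lattice \<Gamma>"
      using aC C(1) by blast
    show "a i \<noteq> 0"
      using aC C(2) vec.dependent_zero by metis
  qed
  then obtain N :: "'n \<Rightarrow> int" where N: "\<And>i. N i > 0"
    "\<And>i g. g \<in> \<Gamma> \<Longrightarrow> of_int (N i) * hprod g (a i) \<in> Z"
    by metis
  define A where "A x = (\<chi> i. of_int (N i) * hprod x (a i))" for x
  have A: "Vector_Spaces.linear (*s) (*s) A"
    by unfold_locales
       (simp_all add: A_def vec_eq_iff hprod_add_left hprod_scale_left algebra_simps)
  have "x = 0" if "A x = 0" for x
  proof -
    have "hprod x (a i) = 0" for i
      using that N(1)[of i] by (simp add: A_def vec_eq_iff) (metis less_irrefl)
    then have "C \<subseteq> {c. hprod x c = 0}"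
      using a by (auto simp: bij_betw_def)
    moreover have "vec.subspace {c. hprod x c = 0}"
      by (auto simp: vec.subspace_def hprod_add_right hprod_scale_right)
    ultimately have "vec.span C \<subseteq> {c. hprod x c = 0}"
      by (rule vec.span_minimal)
    then have "hprod x x = 0"
      using spanC by blast
    then show ?thesis
      by simp
  qed
  then have "inj A"
    by (simp add: linear_injective_0[OF clinear_imp_linear[OF A]])
  moreover have "A g \<in> lattice_power \<Lambda>" if "g \<in> \<Gamma>" for g
    using N(2)[OF that] by (simp add: lattice_power_def A_def vec_\<Lambda>)
  ultimately have "\<exists>\<phi>. isogeny \<Gamma> (lattice_power \<Lambda>) \<phi>"
    by (intro linear_induces_isogeny[OF A _ subgroup span_lattice])
       (auto intro: zmod_subspace_lattice_power discrete_lattice_power complex_lattice_subgroup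
          complex_lattice_discrete \<Lambda>)
  then show ?thesis
    using \<Lambda> CM by (auto simp: isogenous_def)
qed

end

theorem mainTheorem1:
  fixes \<Gamma> :: "(complex^'n) set"
  assumes "complex_lattice \<Gamma>" and "CARD('n) \<ge> 2"
  shows "(\<forall>H. connected_complex_Lie_subgroup \<Gamma> H \<longrightarrow>
              complex_subtorus \<Gamma> (torus_topology \<Gamma> closure_of H)) \<longleftrightarrow>
         (\<exists>\<Lambda> :: (complex^1) set. complex_lattice \<Lambda> \<and> complex_multiplication \<Lambda> \<and>
              isogenous \<Gamma> (lattice_power \<Lambda>))"
proof
  assume closures: "\<forall>H. connected_complex_Lie_subgroup \<Gamma> H \<longrightarrow>
              complex_subtorus \<Gamma> (torus_topology \<Gamma> closure_of H)"
  interpret complex_closure_lattice \<Gamma>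
  proof
    fix V :: "(complex^'n) set" assume V: "vec.subspace V"
    then have "complex_subtorus \<Gamma> (torus_topology \<Gamma> closure_of (torus_proj \<Gamma> ` V))"
      using closures by (auto simp: connected_complex_Lie_subgroup_def)
    then show "\<exists>W. vec.subspace W \<and> closure (saturation \<Gamma> V) = saturation \<Gamma> W"
      by (subst complex_subtorus_closure_of_iff[symmetric])
         (auto intro: complex_lattice_subgroup subspace_imp_zmod_subspace vec_subspace_imp_subspace assms V)
  qed (rule assms)
  show "\<exists>\<Lambda> :: (complex^1) set. complex_lattice \<Lambda> \<and> complex_multiplication \<Lambda> \<and>
              isogenous \<Gamma> (lattice_power \<Lambda>)"
    using assms(2) by (rule isogenous_CM_power)
next
  assume "\<exists>\<Lambda> :: (complex^1) set. complex_lattice \<Lambda> \<and> complex_multiplication \<Lambda> \<and>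
              isogenous \<Gamma> (lattice_power \<Lambda>)"
  then show "\<forall>H. connected_complex_Lie_subgroup \<Gamma> H \<longrightarrow>
              complex_subtorus \<Gamma> (torus_topology \<Gamma> closure_of H)"
    using isogenous_CM_power_imp_closure_complex[OF assms(1)] by blast
qed

end
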